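(* Let $f: X \to Y$ be a continuous mapping of topological spaces. The following conditions are equivalent. (A) The mapping $f$ is normal. (B) For any open $\mathcal{O} \subset Y$, any pair of disjoint subsets $F$ and $T$ closed in $f^{-1}\mathcal{O}$, and any point $y \in \mathcal{O}$, there is a consistent family of binary partitions $\{\mathcal{O}_{n}, \{U_{n}^{k} \mid k\in\overline{0, 2^{n}-1}\} \mid n\in\omega_0\}$ of the mapping $f: X \to Y$ at $y$ such that for any $n \in \mathbb{N}$ (a) $F\cap f^{-1}\mathcal{O}_n\subset U_{n}^{0}$ and $T\cap f^{-1}\mathcal{O}_n\subset U_{n}^{2^{n}-1}$; (b) $F\cap \mathrm{cl}_{f^{-1}\mathcal{O}_n}\big(\bigcup_{k=1}^{2^{n}-1} U_{n}^{k}\big)=\varnothing$ and $\mathrm{cl}_{f^{-1}\mathcal{O}_n}\big(\bigcup_{k=0}^{2^{n}-2} U_{n}^{k}\big) \cap T = \varnothing$. (C) For any open $\mathcal{O}\subset Y$, any pair of disjoint subsets $F$ and $T$ closed in $f^{-1}\mathcal{O}$, and any point $y \in \mathcal{O}$, there exist a function $\varphi: X \to [0,1]$ that is $f$-continuous at $y$ and a neighborhood $\mathcal{O}y$ of $y$ such that $\mathrm{osc}_{\varphi}(f^{-1}\mathcal{O}y)<\frac{1}{2}$, $$F\cap f^{-1}\mathcal{O}y\subset\varphi^{-1}(0)\cap f^{-1}\mathcal{O}y,\qquad T\cap f^{-1}\mathcal{O}y\subset\varphi^{-1}(1)\cap f^{-1}\mathcal{O}y,$$ $$F\cap f^{-1}\mathcal{O}y\subset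 f^{-1}\mathcal{O}y\setminus \mathrm{cl}_{f^{-1}\mathcal{O}y} \big(\varphi^{-1}[\tfrac12, 1]\cap f^{-1}\mathcal{O}y\big),\qquad T\cap f^{-1}\mathcal{O}y\subset\mathrm{int}_{f^{-1}\mathcal{O}y}\big(\varphi^{-1}[\tfrac12, 1]\cap f^{-1}\mathcal{O}y\big).$$ (D) For any open $\mathcal{O} \subset Y$, any non-empty closed subset $F$ of $f^{-1}\mathcal{O}$, any $y \in \mathcal{O}$, and any function $\widetilde{\varphi}: F \to \mathbb{R}$ that is $\widetilde{f}$-continuous at $y$, where $\widetilde{f}: F \to \mathcal{O}$ is the mapping $\widetilde{f}(x) = f(x)$ for $x \in F$, there is a function $\varphi: X\to\mathbb{R}$ that is $f$-continuous at $y$ (for the mapping $f: X \to Y$) such that (a) $\widetilde\varphi|_{F\cap f^{-1}G}=\varphi|_{F\cap f^{-1}G}$ for some $G_{\delta}$-subset $G$ of $\mathcal{O}$ with $y \in G$ (in particular, $\widetilde\varphi|_{F\cap f^{-1}y}=\varphi|_{F\cap f^{-1}y}$); (b) $\|\varphi\|\leqslant\|\widetilde{\varphi}\|$; (c) for any $\varepsilon > 0$ there is a neighborhood $\mathcal{O}(\varepsilon) \subset \mathcal{O}$ of $y$ such that $\big\|\widetilde{\varphi}|_{F\cap f^{-1}\mathcal{O}(\varepsilon)} - \varphi|_{F\cap f^{-1}\mathcal{O}(\varepsilon)}\big\| <\varepsilon$.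
   Context: All spaces are topological spaces without separation axioms; mappings $f:X\to Y$ are continuous; neighborhoods are open. $\mathbb{N}=\{1,2,\dots\}$, $\omega_0=\{0\}\cup\mathbb N$, and $\overline{a,b}$ denotes the integers $a,a+1,\dots,b$. $\mathrm{cl}_Z$, $\mathrm{int}_Z$ are closure and interior in the subspace $Z$. Functions are real-valued and not necessarily continuous. For a bounded function $\varphi$ on a set, $\|\varphi\|$ is the supremum of $|\varphi|$ over its domain (read as $0$ if the domain is empty). For a bounded $\varphi:X\to\mathbb R$ and $x\in X$, $\mathrm{osc}_\varphi(x)=\inf\{\sup_{z\in U}|\varphi(x)-\varphi(z)| : U \text{ an open neighborhood of } x\}$; for non-empty $A\subset X$, $\mathrm{osc}_\varphi(A)=\sup\{\mathrm{osc}_\varphi(x):x\in A\}$, and $\mathrm{osc}_\varphi(\varnothing)=0$. For a mapping $f:X\to Y$, a bounded function $\varphi: X\to\mathbb R$ is $f$-continuous at $y\in Y$ if for any $\varepsilon>0$ there is a neighborhood $\mathcal{O}y$ of $y$ with $\mathrm{osc}_\varphi(f^{-1}\mathcal{O}y)<\varepsilon$. A mapping $f:X\to Y$ is prenormal if for any two disjoint closed subsets $A,B$ of $X$ every point $y\in Y$ has a neighborhood $\mathcal{O}y$ such that $A\cap f^{-1}\mathcal{O}y$ and $B\cap f^{-1}\mathcal{O}y$ have disjoint neighborhoods in $f^{-1}\mathcal{O}y$. The mapping $f$ is normal if for every open $\mathcal{O}\subset Y$ the restriction $f_{\mathcal{O}}: f^{-1}\mathcal{O}\to\mathcal{O}$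 is prenormal. A partition $U^0,\dots,U^{k-1}$ of a space $Z$ (pairwise disjoint, possibly empty sets covering $Z$) is a regular $k$-partition if (1) $\bigcup_{m=0}^{p}U^m$ is closed in $Z$ for $p\in\overline{0,k-1}$; (2) when $k\ge 3$, $\big(\bigcup_{m=0}^{p}U^m\big)\cap\mathrm{cl}\big(\bigcup_{m=p+2}^{k-1}U^m\big)=\varnothing$ for $p\in\overline{0,k-3}$. For $f:X\to Y$ and $y\in Y$, a sequence of neighborhoods $\{\mathcal{O}_n\}_{n\in\omega_0}$ of $y$ with $\mathcal{O}_0=Y$, $\mathcal{O}_{n+1}\subset\mathcal{O}_n$, together with regular $2^n$-partitions $\{U_n^k\mid k\in\overline{0,2^n-1}\}$ of the subspaces $f^{-1}\mathcal{O}_n$, $n\in\omega_0$, is a consistent family of binary partitions of $f$ at $y$ if $U_{n+1}^{2k}\cup U_{n+1}^{2k+1}=U_n^k\cap f^{-1}\mathcal{O}_{n+1}$ for all $n\in\omega_0$ and $k\in\overline{0,2^n-1}$. *)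

theory Defs
  imports "HOL-Analysis.Analysis"
begin

abbreviation preim :: "'a topology \<Rightarrow> ('a \<Rightarrow> 'b) \<Rightarrow> 'b set \<Rightarrow> 'a set" where
  "preim X f S \<equiv> {x \<in> topspace X. f x \<in> S}"

text \<open>A function on a set or on a space is represented by a total HOL function; only
  its values on that set (or on the \<^const>\<open>topspace\<close>) are ever used.
  The real suprema and infima below are meaningful because they are only applied to functions
  that are bounded there.\<close>

definition sup_norm :: "'a set \<Rightarrow> ('a \<Rightarrow> real) \<Rightarrow> real" where
  "sup_norm A \<phi> = (if A = {} then 0 else (SUP x\<in>A. \<bar>\<phi> x\<bar>))"

definition osc_at :: "'a topology \<Rightarrow> ('a \<Rightarrow> real) \<Rightarrow> 'a \<Rightarrow> real" where
  "osc_at X \<phi> x = (INF U \<in> {U. openin X U \<and> x \<in> U}. SUP z\<in>U. \<bar>\<phi> x - \<phi> z\<bar>)"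

definition osc_on :: "'a topology \<Rightarrow> ('a \<Rightarrow> real) \<Rightarrow> 'a set \<Rightarrow> real" where
  "osc_on X \<phi> A = (if A = {} then 0 else (SUP x\<in>A. osc_at X \<phi> x))"

text \<open>Boundedness of the function is part of the notion of \<open>f\<close>-continuity.\<close>

definition map_continuous_at ::
  "'a topology \<Rightarrow> 'b topology \<Rightarrow> ('a \<Rightarrow> 'b) \<Rightarrow> ('a \<Rightarrow> real) \<Rightarrow> 'b \<Rightarrow> bool" where
  "map_continuous_at X Y f \<phi> y \<longleftrightarrow>
     bounded (\<phi> ` topspace X) \<and>
     (\<forall>\<epsilon>>0. \<exists>W. openin Y W \<and> y \<in> W \<and> osc_on X \<phi> (preim X f W) < \<epsilon>)"

definition prenormal_map :: "'a topology \<Rightarrow> 'b topology \<Rightarrow> ('a \<Rightarrow> 'b) \<Rightarrow> bool" where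
  "prenormal_map X Y f \<longleftrightarrow>
     (\<forall>A B. closedin X A \<and> closedin X B \<and> A \<inter> B = {} \<longrightarrow>
        (\<forall>y\<in>topspace Y. \<exists>W. openin Y W \<and> y \<in> W \<and>
           (\<exists>U V. openin (subtopology X (preim X f W)) U \<and>
                  openin (subtopology X (preim X f W)) V \<and>
                  A \<inter> preim X f W \<subseteq> U \<and> B \<inter> preim X f W \<subseteq> V \<and> U \<inter> V = {})))"

definition normal_map :: "'a topology \<Rightarrow> 'b topology \<Rightarrow> ('a \<Rightarrow> 'b) \<Rightarrow> bool" where
  "normal_map X Y f \<longleftrightarrow>
     (\<forall>W. openin Y W \<longrightarrow>
        prenormal_map (subtopology X (preim X f W)) (subtopology Y W) f)"

definition regular_partition :: "'a topology \<Rightarrow> nat \<Rightarrow> (nat \<Rightarrow> 'a set) \<Rightarrow> bool" where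
  "regular_partition Z k U \<longleftrightarrow>
     disjoint_family_on U {..<k} \<and> (\<Union>m<k. U m) = topspace Z \<and>
     (\<forall>p<k. closedin Z (\<Union>m\<le>p. U m)) \<and>
     (3 \<le> k \<longrightarrow>
        (\<forall>p\<le>k - 3. (\<Union>m\<le>p. U m) \<inter> Z closure_of (\<Union>m\<in>{p + 2..k - 1}. U m) = {}))"

text \<open>\<open>N n\<close> is the \<open>n\<close>-th neighbourhood and \<open>U n k\<close>, for \<open>k < 2 ^ n\<close>, the \<open>k\<close>-th member of the
  partition of its preimage.\<close>

definition consistent_binary_partitions ::
  "'a topology \<Rightarrow> 'b topology \<Rightarrow> ('a \<Rightarrow> 'b) \<Rightarrow> 'b \<Rightarrow>
     (nat \<Rightarrow> 'b set) \<Rightarrow> (nat \<Rightarrow> nat \<Rightarrow> 'a set) \<Rightarrow> bool" where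
  "consistent_binary_partitions X Y f y N U \<longleftrightarrow>
     N 0 = topspace Y \<and>
     (\<forall>n. openin Y (N n) \<and> y \<in> N n \<and> N (Suc n) \<subseteq> N n) \<and>
     (\<forall>n. regular_partition (subtopology X (preim X f (N n))) (2 ^ n) (U n)) \<and>
     (\<forall>n. \<forall>k<2 ^ n.
        U (Suc n) (2 * k) \<union> U (Suc n) (2 * k + 1) = U n k \<inter> preim X f (N (Suc n)))"

end

theory Submission
  imports Defs
begin

text \<open>The proof follows the pattern of the theorems of Urysohn and Tietze, with every construction carried out
  over neighbourhoods of the fixed point \<open>y\<close> that shrink from step to step.

  From normality to partitions: normality lets one insert a closed neighbourhood between a closed set and
  an open set around it, after shrinking the neighbourhood of \<open>y\<close> (\<open>normal_map_interpolate\<close>). Start with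
  \<open>F\<close> and the complement of \<open>T\<close>, and at each level insert a set into every gap
  (\<open>separating_chain_refine\<close>). The differences of the successive sets of a level form a regular partition
  (\<open>regular_partition_of_chain\<close>), and the partitions of successive levels are consistent because each
  level contains the restriction of the one before.

  From partitions to functions: the member with index \<open>k\<close> at level \<open>n\<close> stands for the dyadic interval of
  length \<open>1 / 2 ^ n\<close> that starts at \<open>k / 2 ^ n\<close>. The supremum of the left ends is a function which takes
  values in these intervals, and by regularity neighbouring points lie in members with neighbouring
  indices. So its oscillation over the \<open>n\<close>-th neighbourhood is at most \<open>2 / 2 ^ n\<close>
  (\<open>partition_function_osc_within\<close>). Such functions separate \<open>F\<close> from \<open>T\<close> by an interior and the
  complement of a closure, which leads back to normality (\<open>separation_of_interior_closure\<close>).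

  From normality to extension: Tietze's iteration uses the separating functions just obtained. The function
  to be extended need not be continuous, but near \<open>y\<close> its oscillation is small compared with the current
  error, so that the sets where the error is large and positive and where it is large and negative have
  disjoint closures (\<open>map_continuous_at_approximation\<close>). Each step reduces the error by the factor
  \<open>2 / 3\<close> over a smaller neighbourhood of \<open>y\<close>; the limit is therefore exact only over the intersection
  of countably many neighbourhoods (\<open>tietze_for_normal_map\<close>).

  From extension to normality: the indicator of \<open>T\<close> on \<open>F \<union> T\<close> has zero oscillation. An extension is
  close to it over a neighbourhood of \<open>y\<close> and has small oscillation there, so its values below and above
  \<open>1 / 2\<close> separate \<open>F\<close> from \<open>T\<close> (\<open>separation_of_approximate_indicator\<close>).\<close>

section \<open>Oscillation and continuity along a map\<close>

lemma openin_preim: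
  assumes "continuous_map X Y f" "openin Y W"
  shows "openin X (preim X f W)"
  using openin_continuous_map_preimage[OF assms] .

lemma topspace_sub_preim:
  "topspace (subtopology X (preim X f W)) = preim X f W"
  by (auto simp: topspace_subtopology)

lemma bounded_imageE:
  fixes \<phi> :: "'a \<Rightarrow> real"
  assumes "bounded (\<phi> ` A)"
  obtains M where "\<And>x. x \<in> A \<Longrightarrow> \<bar>\<phi> x\<bar> \<le> M"
  using assms unfolding bounded_real by blast

text \<open>The oscillation \<open>osc_on\<close> is a supremum of infima of suprema. This is the bound
  \<open>osc_on X \<phi> A \<le> e\<close> in its usable \<open>\<epsilon>\<close>-neighbourhood form, except that the infimum is required to
  be attained by a neighbourhood. The two differ by an arbitrarily small change of \<open>e\<close>, which the
  definition of continuity along a map absorbs.\<close>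

definition osc_within :: "'a topology \<Rightarrow> ('a \<Rightarrow> real) \<Rightarrow> real \<Rightarrow> 'a set \<Rightarrow> bool" where
  "osc_within X \<phi> e A \<longleftrightarrow>
     (\<forall>x\<in>A. \<exists>U. openin X U \<and> x \<in> U \<and> (\<forall>z\<in>U. \<bar>\<phi> x - \<phi> z\<bar> \<le> e))"

lemma osc_within_mono:
  "osc_within X \<phi> e A \<Longrightarrow> B \<subseteq> A \<Longrightarrow> e \<le> d \<Longrightarrow> osc_within X \<phi> d B"
  unfolding osc_within_def by (meson order_trans subsetD)

lemma bdd_above_variation:
  fixes \<phi> :: "'a \<Rightarrow> real"
  assumes "bounded (\<phi> ` topspace X)" "x \<in> topspace X" "U \<subseteq> topspace X"
  shows "bdd_above ((\<lambda>z. \<bar>\<phi> x - \<phi> z\<bar>) ` U)"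
proof -
  obtain M where M: "\<And>z. z \<in> topspace X \<Longrightarrow> \<bar>\<phi> z\<bar> \<le> M"
    using assms(1) by (rule bounded_imageE) blast
  show ?thesis
  proof (rule bdd_aboveI2)
    fix z assume "z \<in> U"
    then show "\<bar>\<phi> x - \<phi> z\<bar> \<le> 2 * M"
      using M[of x] M[of z] assms by auto
  qed
qed

text \<open>A lower bound that makes the infimum in \<open>osc_at\<close> a genuine one.\<close>

lemma sup_variation_nonneg:
  fixes \<phi> :: "'a \<Rightarrow> real"
  assumes "bounded (\<phi> ` topspace X)" "openin X U" "x \<in> U"
  shows "0 \<le> (SUP z\<in>U. \<bar>\<phi> x - \<phi> z\<bar>)"
proof -
  have "U \<subseteq> topspace X" using assms openin_subset by blast
  then have "\<bar>\<phi> x - \<phi> x\<bar> \<le> (SUP z\<in>U. \<bar>\<phi> x - \<phi> z\<bar>)"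
    using assms bdd_above_variation[OF assms(1) _ \<open>U \<subseteq> topspace X\<close>]
    by (intro cSUP_upper) (auto dest: openin_subset)
  then show ?thesis by simp
qed

lemma bdd_below_variation:
  fixes \<phi> :: "'a \<Rightarrow> real"
  assumes "bounded (\<phi> ` topspace X)"
  shows "bdd_below ((\<lambda>U. SUP z\<in>U. \<bar>\<phi> x - \<phi> z\<bar>) ` {U. openin X U \<and> x \<in> U})"
  using sup_variation_nonneg assms by (intro bdd_belowI2[where m = 0]) auto

lemma osc_at_le:
  fixes \<phi> :: "'a \<Rightarrow> real"
  assumes b: "bounded (\<phi> ` topspace X)" and "openin X U" "x \<in> U"
    and "\<And>z. z \<in> U \<Longrightarrow> \<bar>\<phi> x - \<phi> z\<bar> \<le> e"
  shows "osc_at X \<phi> x \<le> e"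
proof -
  have "osc_at X \<phi> x \<le> (SUP z\<in>U. \<bar>\<phi> x - \<phi> z\<bar>)"
    unfolding osc_at_def using assms bdd_below_variation[OF b]
    by (intro cINF_lower) auto
  also have "\<dots> \<le> e"
    using assms by (intro cSUP_least) auto
  finally show ?thesis .
qed

lemma osc_on_le:
  assumes "bounded (\<phi> ` topspace X)" "osc_within X \<phi> e A" "0 \<le> e"
  shows "osc_on X \<phi> A \<le> e"
proof (cases "A = {}")
  case True
  then show ?thesis using assms by (simp add: osc_on_def)
next
  case False
  then show ?thesis
    using assms osc_at_le[OF assms(1)] unfolding osc_on_def osc_within_def
    by (auto intro!: cSUP_least)
qed

lemma osc_within_of_osc_on:
  assumes b: "bounded (\<phi> ` topspace X)" and "A \<subseteq> topspace X" and less: "osc_on X \<phi> A < e"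
  shows "osc_within X \<phi> e A"
  unfolding osc_within_def
proof
  fix x assume x: "x \<in> A"
  then have xX: "x \<in> topspace X" using assms by blast
  obtain M where M: "\<And>z. z \<in> topspace X \<Longrightarrow> \<bar>\<phi> z\<bar> \<le> M"
    using b by (rule bounded_imageE) blast
  have "osc_at X \<phi> z \<le> 2 * M" if "z \<in> A" for z
  proof (rule osc_at_le[OF b openin_topspace])
    show z: "z \<in> topspace X" using that assms by blast
    show "\<bar>\<phi> z - \<phi> z'\<bar> \<le> 2 * M" if "z' \<in> topspace X" for z'
      using M[OF that] M[OF z] by simp
  qed
  then have "osc_at X \<phi> x \<le> osc_on X \<phi> A"
    unfolding osc_on_def using x by (auto intro!: cSUP_upper bdd_aboveI2[where M = "2 * M"])
  with less have "osc_at X \<phi> x < e" by simp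
  then obtain U where U: "openin X U" "x \<in> U" "(SUP z\<in>U. \<bar>\<phi> x - \<phi> z\<bar>) < e"
    unfolding osc_at_def
    using cINF_less_iff[OF _ bdd_below_variation[OF b, of x]] openin_topspace xX by fastforce
  have "\<bar>\<phi> x - \<phi> z\<bar> \<le> e" if "z \<in> U" for z
  proof -
    have "\<bar>\<phi> x - \<phi> z\<bar> \<le> (SUP z\<in>U. \<bar>\<phi> x - \<phi> z\<bar>)"
      using that bdd_above_variation[OF b xX openin_subset[OF U(1)]] by (rule cSUP_upper)
    then show ?thesis using U(3) by simp
  qed
  then show "\<exists>U. openin X U \<and> x \<in> U \<and> (\<forall>z\<in>U. \<bar>\<phi> x - \<phi> z\<bar> \<le> e)"
    using U by blast
qed

lemma map_continuous_at_iff: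
  "map_continuous_at X Y f \<phi> y \<longleftrightarrow>
     bounded (\<phi> ` topspace X) \<and>
     (\<forall>e>0. \<exists>W. openin Y W \<and> y \<in> W \<and> osc_within X \<phi> e (preim X f W))"
  (is "_ \<longleftrightarrow> ?b \<and> ?loc")
proof -
  have "?loc \<longleftrightarrow> (\<forall>e>0. \<exists>W. openin Y W \<and> y \<in> W \<and> osc_on X \<phi> (preim X f W) < e)" if b: ?b
  proof (intro iffI allI impI)
    fix e :: real assume loc: ?loc and "e > 0"
    then have "e / 2 > 0" by simp
    with loc obtain W where W: "openin Y W" "y \<in> W" "osc_within X \<phi> (e / 2) (preim X f W)"
      by blast
    then have "osc_on X \<phi> (preim X f W) \<le> e / 2"
      using \<open>e > 0\<close> by (intro osc_on_le[OF b]) auto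
    with W \<open>e > 0\<close> show "\<exists>W. openin Y W \<and> y \<in> W \<and> osc_on X \<phi> (preim X f W) < e"
      by (intro exI[of _ W]) auto
  next
    fix e :: real
    assume "\<forall>e>0. \<exists>W. openin Y W \<and> y \<in> W \<and> osc_on X \<phi> (preim X f W) < e" and "e > 0"
    then obtain W where "openin Y W" "y \<in> W" "osc_on X \<phi> (preim X f W) < e" by blast
    moreover have "preim X f W \<subseteq> topspace X" by blast
    ultimately show "\<exists>W. openin Y W \<and> y \<in> W \<and> osc_within X \<phi> e (preim X f W)"
      using osc_within_of_osc_on[OF b] by blast
  qed
  then show ?thesis unfolding map_continuous_at_def by blast
qed

lemma map_continuous_at_add:
  assumes "map_continuous_at X Y f \<phi> y" "map_continuous_at X Y f \<psi> y"
  shows "map_continuous_at X Y f (\<lambda>x. \<phi> x + \<psi> x) y"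
  unfolding map_continuous_at_iff
proof (intro conjI allI impI)
  show "bounded ((\<lambda>x. \<phi> x + \<psi> x) ` topspace X)"
    using assms bounded_plus_comp unfolding map_continuous_at_iff by blast
  fix e :: real assume "e > 0"
  then have "e / 2 > 0" by simp
  then obtain W W' where W: "openin Y W" "y \<in> W" "osc_within X \<phi> (e / 2) (preim X f W)"
    and W': "openin Y W'" "y \<in> W'" "osc_within X \<psi> (e / 2) (preim X f W')"
    using assms unfolding map_continuous_at_iff by meson
  have "osc_within X (\<lambda>x. \<phi> x + \<psi> x) e (preim X f (W \<inter> W'))"
    unfolding osc_within_def
  proof
    fix x assume "x \<in> preim X f (W \<inter> W')"
    then have "x \<in> preim X f W" "x \<in> preim X f W'" by auto
    then obtain U U' where U: "openin X U" "x \<in> U" "\<And>z. z \<in> U \<Longrightarrow> \<bar>\<phi> x - \<phi> z\<bar> \<le> e / 2"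
      and U': "openin X U'" "x \<in> U'" "\<And>z. z \<in> U' \<Longrightarrow> \<bar>\<psi> x - \<psi> z\<bar> \<le> e / 2"
      using W(3) W'(3) unfolding osc_within_def by meson
    show "\<exists>U. openin X U \<and> x \<in> U \<and> (\<forall>z\<in>U. \<bar>(\<phi> x + \<psi> x) - (\<phi> z + \<psi> z)\<bar> \<le> e)"
    proof (intro exI conjI ballI)
      show "openin X (U \<inter> U')" "x \<in> U \<inter> U'" using U U' by auto
      show "\<bar>(\<phi> x + \<psi> x) - (\<phi> z + \<psi> z)\<bar> \<le> e" if "z \<in> U \<inter> U'" for z
      proof -
        have "\<bar>\<phi> x - \<phi> z\<bar> \<le> e / 2" "\<bar>\<psi> x - \<psi> z\<bar> \<le> e / 2"
          using U(3) U'(3) that by auto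
        then show ?thesis by linarith
      qed
    qed
  qed
  with W W' show "\<exists>W. openin Y W \<and> y \<in> W \<and> osc_within X (\<lambda>x. \<phi> x + \<psi> x) e (preim X f W)"
    by (intro exI[of _ "W \<inter> W'"]) auto
qed

text \<open>Composition with a Lipschitz function multiplies all oscillations by at most the constant. This
  covers both truncation and affine rescaling.\<close>

lemma map_continuous_at_lipschitz:
  assumes "map_continuous_at X Y f \<phi> y" and "L > 0"
    and h: "\<And>u v :: real. \<bar>h u - h v\<bar> \<le> L * \<bar>u - v\<bar>"
  shows "map_continuous_at X Y f (\<lambda>x. h (\<phi> x)) y"
  unfolding map_continuous_at_iff
proof (intro conjI allI impI)
  obtain M where M: "\<And>x. x \<in> topspace X \<Longrightarrow> \<bar>\<phi> x\<bar> \<le> M"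
    using assms(1)[unfolded map_continuous_at_iff, THEN conjunct1] by (rule bounded_imageE) blast
  have "\<bar>h (\<phi> x)\<bar> \<le> \<bar>h 0\<bar> + L * M" if "x \<in> topspace X" for x
  proof -
    have "L * \<bar>\<phi> x\<bar> \<le> L * M" using M[OF that] \<open>L > 0\<close> by simp
    with h[of "\<phi> x" 0] show ?thesis by simp
  qed
  then show "bounded ((\<lambda>x. h (\<phi> x)) ` topspace X)"
    unfolding bounded_real by blast
  fix e :: real assume "e > 0"
  then have "e / L > 0" using \<open>L > 0\<close> by simp
  then obtain W where W: "openin Y W" "y \<in> W" "osc_within X \<phi> (e / L) (preim X f W)"
    using assms unfolding map_continuous_at_iff by meson
  have "\<bar>h u - h v\<bar> \<le> e" if "\<bar>u - v\<bar> \<le> e / L" for u v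
  proof -
    have "L * \<bar>u - v\<bar> \<le> e" using that \<open>L > 0\<close> by (simp add: pos_le_divide_eq mult.commute)
    then show ?thesis using h[of u v] by simp
  qed
  then have "osc_within X (\<lambda>x. h (\<phi> x)) e (preim X f W)"
    using W(3) unfolding osc_within_def by meson
  with W show "\<exists>W. openin Y W \<and> y \<in> W \<and> osc_within X (\<lambda>x. h (\<phi> x)) e (preim X f W)"
    by blast
qed

lemma map_continuous_at_uniform_limit:
  assumes "\<And>e. e > 0 \<Longrightarrow> \<exists>s. map_continuous_at X Y f s y \<and> (\<forall>x\<in>topspace X. \<bar>\<phi> x - s x\<bar> \<le> e)"
  shows "map_continuous_at X Y f \<phi> y"
  unfolding map_continuous_at_iff
proof (intro conjI allI impI)
  obtain s where s: "map_continuous_at X Y f s y" "\<forall>x\<in>topspace X. \<bar>\<phi> x - s x\<bar> \<le> 1"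
    using assms[of 1] by auto
  obtain M where M: "\<And>x. x \<in> topspace X \<Longrightarrow> \<bar>s x\<bar> \<le> M"
    using s(1)[unfolded map_continuous_at_iff, THEN conjunct1] by (rule bounded_imageE) blast
  have "\<bar>\<phi> x\<bar> \<le> M + 1" if "x \<in> topspace X" for x
    using M[OF that] s(2) that by (smt (verit))
  then show "bounded (\<phi> ` topspace X)"
    unfolding bounded_real by blast
  fix e :: real assume "e > 0"
  then have e: "e / 3 > 0" by simp
  obtain s where s: "map_continuous_at X Y f s y" "\<And>x. x \<in> topspace X \<Longrightarrow> \<bar>\<phi> x - s x\<bar> \<le> e / 3"
    using assms[OF e] by auto
  obtain W where W: "openin Y W" "y \<in> W" "osc_within X s (e / 3) (preim X f W)"
    using s(1) e unfolding map_continuous_at_iff by meson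
  have "osc_within X \<phi> e (preim X f W)"
    unfolding osc_within_def
  proof
    fix x assume x: "x \<in> preim X f W"
    then obtain U where U: "openin X U" "x \<in> U" "\<And>z. z \<in> U \<Longrightarrow> \<bar>s x - s z\<bar> \<le> e / 3"
      using W(3) unfolding osc_within_def by meson
    have "\<bar>\<phi> x - \<phi> z\<bar> \<le> e" if "z \<in> U" for z
    proof -
      have "x \<in> topspace X" "z \<in> topspace X" using x openin_subset[OF U(1)] that by auto
      then have "\<bar>\<phi> x - s x\<bar> \<le> e / 3" "\<bar>\<phi> z - s z\<bar> \<le> e / 3" "\<bar>s x - s z\<bar> \<le> e / 3"
        using s(2) U(3)[OF that] by auto
      then show ?thesis by linarith
    qed
    with U show "\<exists>U. openin X U \<and> x \<in> U \<and> (\<forall>z\<in>U. \<bar>\<phi> x - \<phi> z\<bar> \<le> e)"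
      by blast
  qed
  with W show "\<exists>W. openin Y W \<and> y \<in> W \<and> osc_within X \<phi> e (preim X f W)"
    by blast
qed

section \<open>Normality as separation by open sets\<close>

text \<open>The separating sets are open in \<open>X\<close> itself, so they can be restricted to smaller neighbourhoods and
  combined without reference to the subspaces in which they were found.\<close>

lemma normal_map_iff:
  assumes f: "continuous_map X Y f"
  shows "normal_map X Y f \<longleftrightarrow>
    (\<forall>W A B y. openin Y W \<longrightarrow> closedin (subtopology X (preim X f W)) A \<longrightarrow>
        closedin (subtopology X (preim X f W)) B \<longrightarrow> A \<inter> B = {} \<longrightarrow> y \<in> W \<longrightarrow>
      (\<exists>V S T. openin Y V \<and> y \<in> V \<and> V \<subseteq> W \<and> openin X S \<and> openin X T \<and>
         A \<inter> preim X f V \<subseteq> S \<and> B \<inter> preim X f V \<subseteq> T \<and> S \<inter> T = {}))"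
    (is "_ \<longleftrightarrow> (\<forall>W A B y. ?sep W A B y)")
proof -
  \<comment> \<open>Inside \<open>f\<close>-preimages of open sets every relatively open set is open, so the iterated
    subspaces in the definition disappear.\<close>
  have pre: "preim (subtopology X (preim X f W)) f V = preim X f V" if "V \<subseteq> W" for V W
    using that by auto
  have open_sub: "openin (subtopology Y W) V \<longleftrightarrow> openin Y V \<and> V \<subseteq> W" if "openin Y W" for V W
    using that by (simp add: openin_open_subtopology)
  have open_pre: "openin (subtopology (subtopology X (preim X f W)) (preim X f V)) S \<longleftrightarrow>
      openin X S \<and> S \<subseteq> preim X f V" if "openin Y V" "V \<subseteq> W" for V W S
  proof -
    have "preim X f W \<inter> preim X f V = preim X f V" using that by auto
    then show ?thesis
      using that openin_preim[OF f] by (simp add: subtopology_subtopology openin_open_subtopology)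
  qed
  have Y: "topspace (subtopology Y W) = W" if "openin Y W" for W
    using that openin_subset by (auto simp: topspace_subtopology)
  show ?thesis
  proof (intro iffI allI)
    fix W A B y
    assume n: "normal_map X Y f"
    show "?sep W A B y"
    proof (intro impI)
      assume W: "openin Y W" "y \<in> W" and AB: "A \<inter> B = {}"
        "closedin (subtopology X (preim X f W)) A" "closedin (subtopology X (preim X f W)) B"
      from n W(1) have "prenormal_map (subtopology X (preim X f W)) (subtopology Y W) f"
        unfolding normal_map_def by blast
      from this[unfolded prenormal_map_def, rule_format, OF conjI[OF AB(2) conjI[OF AB(3,1)]],
          unfolded Y[OF W(1)], OF W(2)]
      obtain V S T where V: "openin (subtopology Y W) V" "y \<in> V" and ST:
        "openin (subtopology (subtopology X (preim X f W)) (preim (subtopology X (preim X f W)) f V)) S"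
        "openin (subtopology (subtopology X (preim X f W)) (preim (subtopology X (preim X f W)) f V)) T"
        "A \<inter> preim (subtopology X (preim X f W)) f V \<subseteq> S"
        "B \<inter> preim (subtopology X (preim X f W)) f V \<subseteq> T" "S \<inter> T = {}"
        by blast
      have V': "openin Y V" "V \<subseteq> W" using V open_sub[OF W(1)] by auto
      have "openin X S" "openin X T"
        using ST(1,2) unfolding pre[OF V'(2)] open_pre[OF V'] by simp_all
      moreover have "A \<inter> preim X f V \<subseteq> S" "B \<inter> preim X f V \<subseteq> T"
        using ST(3,4) unfolding pre[OF V'(2)] by (simp_all only:)
      ultimately show "\<exists>V S T. openin Y V \<and> y \<in> V \<and> V \<subseteq> W \<and> openin X S \<and>
         openin X T \<and> A \<inter> preim X f V \<subseteq> S \<and> B \<inter> preim X f V \<subseteq> T \<and> S \<inter> T = {}"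
        using V(2) V' ST(5)
        by (intro exI[of _ V] exI[of _ S] exI[of _ T] conjI) assumption+
    qed
  next
    assume sep: "\<forall>W A B y. ?sep W A B y"
    show "normal_map X Y f"
      unfolding normal_map_def prenormal_map_def
    proof (intro allI impI ballI, elim conjE)
      fix W A B y
      assume W: "openin Y W" "y \<in> topspace (subtopology Y W)" and AB: "A \<inter> B = {}"
        "closedin (subtopology X (preim X f W)) A" "closedin (subtopology X (preim X f W)) B"
      then obtain V S T where V: "openin Y V" "y \<in> V" "V \<subseteq> W"
        and ST: "openin X S" "openin X T" "A \<inter> preim X f V \<subseteq> S" "B \<inter> preim X f V \<subseteq> T"
          "S \<inter> T = {}"
        using sep[rule_format, OF W(1) AB(2,3,1), of y] Y[OF W(1)] by auto
      show "\<exists>V. openin (subtopology Y W) V \<and> y \<in> V \<and>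
          (\<exists>S T. openin (subtopology (subtopology X (preim X f W))
                     (preim (subtopology X (preim X f W)) f V)) S \<and>
             openin (subtopology (subtopology X (preim X f W))
                     (preim (subtopology X (preim X f W)) f V)) T \<and>
             A \<inter> preim (subtopology X (preim X f W)) f V \<subseteq> S \<and>
             B \<inter> preim (subtopology X (preim X f W)) f V \<subseteq> T \<and> S \<inter> T = {})"
      proof (intro exI conjI)
        show "openin (subtopology Y W) V" using V open_sub[OF W(1)] by blast
        have "openin X (S \<inter> preim X f V)" "openin X (T \<inter> preim X f V)"
          by (intro openin_Int ST openin_preim[OF f V(1)])+
        then show "openin (subtopology (subtopology X (preim X f W))
              (preim (subtopology X (preim X f W)) f V)) (S \<inter> preim X f V)"
          "openin (subtopology (subtopology X (preim X f W))
              (preim (subtopology X (preim X f W)) f V)) (T \<inter> preim X f V)"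
          unfolding pre[OF V(3)] open_pre[OF V(1,3)] by blast+
        show "y \<in> V" by fact
        show "A \<inter> preim (subtopology X (preim X f W)) f V \<subseteq> S \<inter> preim X f V"
          "B \<inter> preim (subtopology X (preim X f W)) f V \<subseteq> T \<inter> preim X f V"
          "S \<inter> preim X f V \<inter> (T \<inter> preim X f V) = {}"
          using ST unfolding pre[OF V(3)] by blast+
      qed
    qed
  qed
qed

section \<open>Chains of closed sets and regular partitions\<close>

lemma closedin_sub_restrict:
  assumes "closedin (subtopology X A) D" "B \<subseteq> A"
  shows "closedin (subtopology X B) (D \<inter> B)"
proof -
  obtain C where "closedin X C" "D = C \<inter> A"
    using assms(1) unfolding closedin_subtopology by blast
  then have "closedin X C \<and> D \<inter> B = C \<inter> B" using assms(2) by blast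
  then show ?thesis unfolding closedin_subtopology by blast
qed

lemma chain_mono:
  fixes L :: "nat \<Rightarrow> 'a set"
  assumes "\<And>i. i < K \<Longrightarrow> L i \<subseteq> L (Suc i)" and "i \<le> j" "j \<le> K"
  shows "L i \<subseteq> L j"
  using \<open>i \<le> j\<close> \<open>j \<le> K\<close>
proof (induction j rule: dec_induct)
  case (step j)
  then have "L j \<subseteq> L (Suc j)" using assms(1) by simp
  with step show ?case by auto
qed simp

lemma UN_chain_differences:
  fixes L :: "nat \<Rightarrow> 'a set"
  assumes mono: "\<And>i. i < K \<Longrightarrow> L i \<subseteq> L (Suc i)" and "a \<le> b" "b \<le> K"
  shows "(\<Union>m\<in>{a..<b}. L (Suc m) - L m) = L b - L a"
  using \<open>a \<le> b\<close> \<open>b \<le> K\<close>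
proof (induction b rule: dec_induct)
  case (step b)
  have "L a \<subseteq> L b" "L b \<subseteq> L (Suc b)"
    using chain_mono[of K L a b] mono step by auto
  moreover have "{a..<Suc b} = insert b {a..<b}" using step by auto
  ultimately show ?case using step by auto
qed simp

text \<open>A regular partition is the same thing as the family of differences of a finite chain of closed sets
  each of which lies in the interior of its successor: the second condition on a regular partition says
  that \<open>L (p + 1)\<close> misses the closure of the complement of \<open>L (p + 2)\<close>.\<close>

lemma regular_partition_of_chain:
  assumes L0: "L 0 = {}" and LK: "L K = topspace Z"
    and closed: "\<And>i. i \<le> K \<Longrightarrow> closedin Z (L i)"
    and int: "\<And>i. i < K \<Longrightarrow> L i \<subseteq> Z interior_of L (Suc i)"
  shows "regular_partition Z K (\<lambda>k. L (Suc k) - L k)"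
proof -
  have mono: "L i \<subseteq> L (Suc i)" if "i < K" for i
    using int[OF that] interior_of_subset by fast
  have upto: "(\<Union>m\<le>p. L (Suc m) - L m) = L (Suc p)" if "p < K" for p
    using UN_chain_differences[of K L 0 "Suc p"] mono that L0
    by (simp add: atLeast0LessThan lessThan_Suc_atMost)
  have "(L (Suc k) - L k) \<inter> (L (Suc l) - L l) = {}" if "k < l" "l < K" for k l
    using chain_mono[of K L "Suc k" l] mono that by auto
  then have "disjoint_family_on (\<lambda>k. L (Suc k) - L k) {..<K}"
    unfolding disjoint_family_on_def by (metis inf_commute lessThan_iff nat_neq_iff)
  moreover have "(\<Union>m<K. L (Suc m) - L m) = topspace Z"
    using UN_chain_differences[of K L 0 K] mono L0 LK by (simp add: atLeast0LessThan)
  moreover have "(\<Union>m\<le>p. L (Suc m) - L m) \<inter>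
      Z closure_of (\<Union>m\<in>{p + 2..K - 1}. L (Suc m) - L m) = {}" if "3 \<le> K" "p \<le> K - 3" for p
  proof -
    have "{p + 2..K - 1} = {p + 2..<K}" using that by auto
    then have "(\<Union>m\<in>{p + 2..K - 1}. L (Suc m) - L m) = topspace Z - L (p + 2)"
      using UN_chain_differences[of K L "p + 2" K] mono that LK by simp
    moreover have "L (Suc p) \<subseteq> Z interior_of L (p + 2)"
      using int[of "Suc p"] that by simp
    ultimately show ?thesis
      using upto[of p] that by (simp add: closure_of_complement disjoint_iff) blast
  qed
  ultimately show ?thesis
    unfolding regular_partition_def using upto closed by simp
qed

section \<open>Separating chains and their refinement\<close>

lemma normal_map_separates:
  assumes f: "continuous_map X Y f" and n: "normal_map X Y f"
    and W: "openin Y W" "y \<in> W"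
    and A: "closedin (subtopology X (preim X f W)) A"
    and B: "closedin (subtopology X (preim X f W)) B" and "A \<inter> B = {}"
  obtains V S T where "openin Y V" "y \<in> V" "V \<subseteq> W" "openin X S" "openin X T"
    "A \<inter> preim X f V \<subseteq> S" "B \<inter> preim X f V \<subseteq> T" "S \<inter> T = {}"
  using n[unfolded normal_map_iff[OF f], rule_format, OF W(1) A B \<open>A \<inter> B = {}\<close> W(2)]
  by (elim exE conjE) (rule that)

text \<open>The classical reformulation of normality: between a closed set and an open set around it one can
  insert a closed neighbourhood \<open>E\<close> of the closed set. Here the insertion is possible after shrinking
  the neighbourhood of \<open>y\<close>.\<close>

lemma normal_map_interpolate:
  assumes f: "continuous_map X Y f" and n: "normal_map X Y f"
    and V: "openin Y V" "y \<in> V"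
    and C: "closedin (subtopology X (preim X f V)) C" and G: "openin X G" "C \<subseteq> G"
  obtains V' E where "openin Y V'" "y \<in> V'" "V' \<subseteq> V"
    "closedin (subtopology X (preim X f V')) E" "C \<inter> preim X f V' \<subseteq> X interior_of E" "E \<subseteq> G"
proof -
  have "closedin (subtopology X (preim X f V)) (preim X f V - G)"
    unfolding closedin_subtopology
    using G(1) by (intro exI[of _ "topspace X - G"]) auto
  moreover have "C \<inter> (preim X f V - G) = {}" using G by blast
  ultimately obtain V' S T where V': "openin Y V'" "y \<in> V'" "V' \<subseteq> V" and ST: "openin X S" "openin X T"
    "C \<inter> preim X f V' \<subseteq> S" "(preim X f V - G) \<inter> preim X f V' \<subseteq> T" "S \<inter> T = {}"
    by (rule normal_map_separates[OF f n V C])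
  define E where "E = preim X f V' - T"
  show ?thesis
  proof
    show "openin Y V'" "y \<in> V'" "V' \<subseteq> V" by fact+
    have "closedin X (topspace X - T)" using ST by blast
    moreover have "E = (topspace X - T) \<inter> preim X f V'" by (auto simp: E_def)
    ultimately show "closedin (subtopology X (preim X f V')) E"
      unfolding closedin_subtopology by blast
    have "S \<inter> preim X f V' \<subseteq> X interior_of E"
      using ST openin_preim[OF f V'(1)] by (intro interior_of_maximal) (auto simp: E_def)
    then show "C \<inter> preim X f V' \<subseteq> X interior_of E" using ST by blast
    show "E \<subseteq> G" using ST V' by (auto simp: E_def)
  qed
qed

text \<open>Starting from \<open>F\<close> and
  ending with the complement of \<open>T\<close> makes the separation of \<open>F\<close> and \<open>T\<close> one more instance of the
  chain condition, so that the refinement step needs no special treatment at the two ends.\<close>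

definition separating_chain ::
  "'a topology \<Rightarrow> 'a set \<Rightarrow> 'a set \<Rightarrow> 'a set \<Rightarrow> nat \<Rightarrow> (nat \<Rightarrow> 'a set) \<Rightarrow> bool" where
  "separating_chain X P F T n D \<longleftrightarrow>
     D 0 = F \<inter> P \<and> D (2 ^ n) = P - T \<and>
     (\<forall>i<2 ^ n. closedin (subtopology X P) (D i) \<and> D i \<subseteq> X interior_of D (Suc i))"

text \<open>A closed set is inserted in each of the \<open>2 ^ n\<close> gaps. Each insertion shrinks the neighbourhood of
  \<open>y\<close>, but there are finitely many of them, so a common neighbourhood exists. Over the infinitely many
  levels the neighbourhoods need not have a common one, which is the reason for the sequence of
  neighbourhoods in the notion of a consistent family.\<close>

lemma separating_chain_refine:
  assumes f: "continuous_map X Y f" and n: "normal_map X Y f"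
    and V: "openin Y V" "y \<in> V"
    and D: "separating_chain X (preim X f V) F T n D"
  obtains V' D' where "openin Y V'" "y \<in> V'" "V' \<subseteq> V"
    "separating_chain X (preim X f V') F T (Suc n) D'"
    "\<forall>i\<le>2 ^ n. D' (2 * i) = D i \<inter> preim X f V'"
proof -
  define Q where "Q i V' E \<longleftrightarrow> openin Y V' \<and> y \<in> V' \<and> V' \<subseteq> V \<and>
      closedin (subtopology X (preim X f V')) E \<and>
      D i \<inter> preim X f V' \<subseteq> X interior_of E \<and> E \<subseteq> X interior_of D (Suc i)" for i V' E
  have "\<exists>V' E. Q i V' E" if "i < 2 ^ n" for i
  proof -
    have "closedin (subtopology X (preim X f V)) (D i)" "D i \<subseteq> X interior_of D (Suc i)"
      using D that unfolding separating_chain_def by auto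
    then obtain V' E where "openin Y V'" "y \<in> V'" "V' \<subseteq> V"
      "closedin (subtopology X (preim X f V')) E" "D i \<inter> preim X f V' \<subseteq> X interior_of E"
      "E \<subseteq> X interior_of D (Suc i)"
      by (rule normal_map_interpolate[OF f n V _ openin_interior_of])
    then show ?thesis unfolding Q_def by (intro exI conjI)
  qed
  then obtain Vf E where "\<And>i. i < 2 ^ n \<Longrightarrow> Q i (Vf i) (E i)"
    by metis
  then have VE: "\<And>i. i < 2 ^ n \<Longrightarrow> openin Y (Vf i) \<and> y \<in> Vf i \<and> Vf i \<subseteq> V \<and>
      closedin (subtopology X (preim X f (Vf i))) (E i) \<and>
      D i \<inter> preim X f (Vf i) \<subseteq> X interior_of E i \<and> E i \<subseteq> X interior_of D (Suc i)"
    unfolding Q_def .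
  define V' where "V' = (\<Inter>i<2 ^ n. Vf i)"
  define D' where "D' = (\<lambda>j. (if even j then D (j div 2) else E (j div 2)) \<inter> preim X f V')"
  have "openin Y V'" unfolding V'_def using VE by (intro openin_INT2) (auto simp: lessThan_empty_iff)
  moreover have "y \<in> V'" using VE by (auto simp: V'_def)
  moreover have V'Vf: "V' \<subseteq> Vf i" if "i < 2 ^ n" for i using that by (auto simp: V'_def)
  moreover have V'V: "V' \<subseteq> V" using V'Vf[of 0] VE[of 0] by auto
  moreover have "separating_chain X (preim X f V') F T (Suc n) D'"
    unfolding separating_chain_def
  proof (intro conjI allI impI)
    show "D' 0 = F \<inter> preim X f V'" "D' (2 ^ Suc n) = preim X f V' - T"
      using D V'V by (auto simp: D'_def separating_chain_def)
    have open': "X interior_of preim X f V' = preim X f V'"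
      using openin_preim[OF f \<open>openin Y V'\<close>] by (rule interior_of_openin)
    fix j :: nat assume j: "j < 2 ^ Suc n"
    define i where "i = j div 2"
    have i: "i < 2 ^ n" using j by (auto simp: i_def)
    have pre: "preim X f V' \<subseteq> preim X f (Vf i)" "preim X f V' \<subseteq> preim X f V"
      using V'Vf[OF i] V'V by auto
    have Di: "closedin (subtopology X (preim X f V)) (D i)"
      using D i unfolding separating_chain_def by blast
    show "closedin (subtopology X (preim X f V')) (D' j)"
      using closedin_sub_restrict[OF Di pre(2)] closedin_sub_restrict[OF _ pre(1), where D = "E i"] VE[OF i]
      by (simp add: D'_def i_def)
    show "D' j \<subseteq> X interior_of D' (Suc j)"
    proof (cases "even j")
      case True
      then have "D' j = D i \<inter> preim X f V'" "D' (Suc j) = E i \<inter> preim X f V'"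
        by (auto simp: D'_def i_def)
      then show ?thesis using VE[OF i] pre by (auto simp: interior_of_Int open')
    next
      case False
      then have "D' j = E i \<inter> preim X f V'" "D' (Suc j) = D (Suc i) \<inter> preim X f V'"
        by (auto simp: D'_def i_def)
      then show ?thesis using VE[OF i] pre by (auto simp: interior_of_Int open')
    qed
  qed
  moreover have "D' (2 * i) = D i \<inter> preim X f V'" for i
    by (simp add: D'_def)
  ultimately show thesis using that[of V' D'] by simp
qed

lemma normal_map_imp_separating_chains:
  assumes f: "continuous_map X Y f" and n: "normal_map X Y f"
    and W: "openin Y W" "y \<in> W"
    and F: "closedin (subtopology X (preim X f W)) F"
    and T: "closedin (subtopology X (preim X f W)) T" and "F \<inter> T = {}"
  obtains V D where "\<And>n. openin Y (V n)" "\<And>n. y \<in> V n" "\<And>n. V n \<subseteq> W"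
    "\<And>n. V (Suc n) \<subseteq> V n" "\<And>n. separating_chain X (preim X f (V n)) F T n (D n)"
    "\<And>n i. i \<le> 2 ^ n \<Longrightarrow> D (Suc n) (2 * i) = D n i \<inter> preim X f (V (Suc n))"
proof -
  define P where "P = (\<lambda>n (V, D). openin Y V \<and> y \<in> V \<and> V \<subseteq> W \<and>
    separating_chain X (preim X f V) F T n D)"
  define Q where "Q = (\<lambda>n (V, D :: nat \<Rightarrow> 'a set) (V', D' :: nat \<Rightarrow> 'a set). V' \<subseteq> V \<and>
    (\<forall>i\<le>2 ^ n. D' (2 * i) = D i \<inter> preim X f V'))"
  have "\<exists>s. P 0 s"
  proof
    define D where "D = (\<lambda>i::nat. if i = 0 then F else preim X f W - T)"
    have sub: "F \<subseteq> preim X f W" "T \<subseteq> preim X f W"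
      using F T closedin_subset by fastforce+
    have "openin (subtopology X (preim X f W)) (preim X f W - T)"
      using openin_diff[OF openin_topspace T] by (simp only: topspace_sub_preim)
    then have "openin X (preim X f W - T)"
      by (rule openin_trans_full[OF _ openin_preim[OF f W(1)]])
    then have "F \<subseteq> X interior_of (preim X f W - T)"
      using sub \<open>F \<inter> T = {}\<close> by (simp only: interior_of_openin) blast
    then show "P 0 (W, D)"
      using W F sub by (auto simp: P_def separating_chain_def D_def)
  qed
  moreover have "\<exists>t. P (Suc n) t \<and> Q n s t" if "P n s" for n s
  proof -
    obtain V D where s: "s = (V, D)" by fastforce
    with that have "openin Y V" "y \<in> V" "V \<subseteq> W" "separating_chain X (preim X f V) F T n D"
      by (auto simp: P_def)
    obtain V' D' where "openin Y V'" "y \<in> V'" "V' \<subseteq> V"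
      "separating_chain X (preim X f V') F T (Suc n) D'"
      "\<forall>i\<le>2 ^ n. D' (2 * i) = D i \<inter> preim X f V'"
      by (rule separating_chain_refine[OF f n \<open>openin Y V\<close> \<open>y \<in> V\<close>
            \<open>separating_chain X (preim X f V) F T n D\<close>])
    moreover from this have "V' \<subseteq> W" using \<open>V \<subseteq> W\<close> by (rule_tac subset_trans)
    ultimately show ?thesis
      by (intro exI[of _ "(V', D')"]) (simp add: P_def Q_def s)
  qed
  ultimately obtain s where s: "\<And>n. P n (s n)" "\<And>n. Q n (s n) (s (Suc n))"
    using dependent_nat_choice[of P Q] by metis
  show thesis
    by (rule that[of "\<lambda>n. fst (s n)" "\<lambda>n. snd (s n)"])
      (use s in \<open>auto simp: P_def Q_def case_prod_beta\<close>)
qed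

section \<open>Consistent families of partitions\<close>

text \<open>The \<open>n\<close>-th partition consists of the differences of the \<open>n\<close>-th chain after its two end members have
  been replaced by the empty set and the whole preimage; these replacements put \<open>F\<close> into the first and
  \<open>T\<close> into the last member. Level \<open>0\<close> is treated apart, since the chain starts over a neighbourhood
  in which \<open>F\<close> and \<open>T\<close> are closed, whereas a consistent family starts over the whole space.\<close>

lemma consistent_partitions_of_separating_chains:
  assumes V: "\<And>n. openin Y (V n)" "\<And>n. y \<in> V n" "\<And>n. V (Suc n) \<subseteq> V n"
    and chain: "\<And>n. separating_chain X (preim X f (V n)) F T n (D n)"
    and step: "\<And>n i. i \<le> 2 ^ n \<Longrightarrow> D (Suc n) (2 * i) = D n i \<inter> preim X f (V (Suc n))"
    and f: "continuous_map X Y f"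
  shows "\<exists>N U. consistent_binary_partitions X Y f y N U \<and>
          (\<forall>n\<ge>1.
             F \<inter> preim X f (N n) \<subseteq> U n 0 \<and>
             T \<inter> preim X f (N n) \<subseteq> U n (2 ^ n - 1) \<and>
             F \<inter> (subtopology X (preim X f (N n)) closure_of (\<Union>k\<in>{1..2 ^ n - 1}. U n k)) = {} \<and>
             (subtopology X (preim X f (N n)) closure_of (\<Union>k\<in>{0..2 ^ n - 2}. U n k)) \<inter> T = {})"
proof -
  define N where "N n = (if n = 0 then topspace Y else V n)" for n
  let ?P = "\<lambda>n. preim X f (N n)" and ?Z = "\<lambda>n. subtopology X (preim X f (N n))"
  define L where "L n i = (if i = 0 then {} else if 2 ^ n \<le> i then ?P n else D n i)" for n i
  define U where "U n k = L n (Suc k) - L n k" for n k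
  have V_top: "V n \<subseteq> topspace Y" for n using V(1) openin_subset by blast
  have NV: "N (Suc n) = V (Suc n)" for n by (simp add: N_def)
  have N: "openin Y (N n)" "y \<in> N n" "N (Suc n) \<subseteq> N n" for n
    using V V_top[of n] V_top[of "Suc n"] subsetD[OF V_top V(2)] by (auto simp: N_def)
  have D: "D n 0 = F \<inter> ?P n" "D n (2 ^ n) = ?P n - T"
    "\<And>i. i < 2 ^ n \<Longrightarrow> closedin (?Z n) (D n i)"
    "\<And>i. i < 2 ^ n \<Longrightarrow> D n i \<subseteq> X interior_of D n (Suc i)" if "n > 0" for n
    using chain[of n] that unfolding separating_chain_def N_def by auto
  have DP: "D n i \<subseteq> ?P n" if "n > 0" "i \<le> 2 ^ n" for n i
  proof (cases "i = 2 ^ n")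
    case True
    then show ?thesis using D(2)[OF that(1)] by auto
  next
    case False
    then show ?thesis using closedin_subset[OF D(3)[OF that(1), of i]] that by simp
  qed
  have L_ends: "L n 0 = {}" "L n (2 ^ n) = topspace (?Z n)" for n
    by (auto simp: L_def topspace_subtopology)
  have open_int: "?Z n interior_of A = X interior_of A" if "A \<subseteq> ?P n" for n A
    using openin_preim[OF f N(1)[of n]] that
    by (metis inf.absorb_iff2 interior_of_subset interior_of_subtopology_open subset_trans)
  have L_closed: "closedin (?Z n) (L n i)" if "i \<le> 2 ^ n" for n i
  proof (cases "n = 0")
    case True
    then show ?thesis using that closedin_topspace[of "?Z n"] by (auto simp: L_def)
  next
    case False
    then show ?thesis
      using that closedin_topspace[of "?Z n"] D(3)[of n i] by (auto simp: L_def)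
  qed
  have int_top: "?Z n interior_of ?P n = ?P n" for n
    using interior_of_topspace[of "?Z n"] by (simp only: topspace_sub_preim)
  have L_int: "L n i \<subseteq> ?Z n interior_of L n (Suc i)" if "i < 2 ^ n" for n i
  proof (cases "i = 0 \<or> 2 ^ n \<le> Suc i")
    case True
    with that L_closed[of i n] closedin_subset[of "?Z n" "L n i"] show ?thesis
      by (auto simp: L_def int_top)
  next
    case False
    then have "n > 0" by (cases n) auto
    with False D(4)[of n i] DP[of n "Suc i"] show ?thesis
      by (auto simp: L_def open_int)
  qed
  have L_mono: "L n i \<subseteq> L n (Suc i)" if "i < 2 ^ n" for n i
    using L_int[OF that] interior_of_subset by fast
  have L_double: "L (Suc n) (2 * i) = L n i \<inter> ?P (Suc n)" if "i \<le> 2 ^ n" for n i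
  proof (cases "i = 0 \<or> i = 2 ^ n")
    case True
    then show ?thesis using N(3)[of n] by (auto simp: L_def)
  next
    case False
    then have "0 < i" "i < 2 ^ n" using that by auto
    then show ?thesis using step[of i n] by (simp add: L_def NV)
  qed
  have regular: "regular_partition (?Z n) (2 ^ n) (U n)" for n
  proof -
    have "U n = (\<lambda>k. L n (Suc k) - L n k)" by (simp add: U_def fun_eq_iff)
    then show ?thesis
      using regular_partition_of_chain[of "L n" "2 ^ n" "?Z n", OF L_ends L_closed L_int] by simp
  qed
  have "U (Suc n) (2 * k) \<union> U (Suc n) (2 * k + 1) = U n k \<inter> ?P (Suc n)" if "k < 2 ^ n" for n k
  proof -
    have "L (Suc n) (2 * k) \<subseteq> L (Suc n) (2 * k + 1)" "L (Suc n) (2 * k + 1) \<subseteq> L (Suc n) (2 * k + 2)"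
      using L_mono[of "2 * k" "Suc n"] L_mono[of "2 * k + 1" "Suc n"] that by auto
    then have "U (Suc n) (2 * k) \<union> U (Suc n) (2 * k + 1) = L (Suc n) (2 * Suc k) - L (Suc n) (2 * k)"
      by (auto simp: U_def)
    also have "\<dots> = U n k \<inter> ?P (Suc n)"
      using L_double[of k n] L_double[of "Suc k" n] that by (auto simp: U_def)
    finally show ?thesis .
  qed
  then have "consistent_binary_partitions X Y f y N U"
    unfolding consistent_binary_partitions_def using N regular by (simp add: N_def)
  moreover have "F \<inter> ?P n \<subseteq> U n 0 \<and> T \<inter> ?P n \<subseteq> U n (2 ^ n - 1) \<and>
      F \<inter> (?Z n closure_of (\<Union>k\<in>{1..2 ^ n - 1}. U n k)) = {} \<and>
      (?Z n closure_of (\<Union>k\<in>{0..2 ^ n - 2}. U n k)) \<inter> T = {}" if "n \<ge> 1" for n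
  proof -
    have n: "n > 0" and two: "(2::nat) ^ n \<ge> 2"
      using that by (cases n, auto)+
    then have L1: "L n 1 = D n 1" and Llast: "L n (2 ^ n - 1) = D n (2 ^ n - 1)"
      and LK: "L n (2 ^ n) = ?P n"
      by (auto simp: L_def)
    have F1: "F \<inter> ?P n \<subseteq> X interior_of D n 1"
      using D(1)[OF n] D(4)[OF n, of 0] by simp
    have T1: "T \<inter> D n (2 ^ n - 1) = {}"
      using D(2)[OF n] D(4)[OF n, of "2 ^ n - 1"] interior_of_subset[of X "D n (2 ^ n)"] two by auto
    have "F \<inter> ?P n \<subseteq> U n 0"
      using F1 interior_of_subset[of X "D n 1"] L1 L_ends by (auto simp: U_def)
    moreover have "T \<inter> ?P n \<subseteq> U n (2 ^ n - 1)"
      using T1 Llast LK two by (auto simp: U_def)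
    moreover have "F \<inter> (?Z n closure_of (\<Union>k\<in>{1..2 ^ n - 1}. U n k)) = {}"
    proof -
      have "{1..2 ^ n - 1} = {1..<2 ^ n :: nat}" by auto
      then have "(\<Union>k\<in>{1..2 ^ n - 1}. U n k) = ?P n - D n 1"
        using UN_chain_differences[of "2 ^ n" "L n" 1 "2 ^ n"] L_mono two L1 LK by (simp add: U_def)
      then have "?Z n closure_of (\<Union>k\<in>{1..2 ^ n - 1}. U n k) = ?P n - X interior_of D n 1"
        using open_int[of "D n 1" n] DP[OF n, of 1] two
          closure_of_complement[of "?Z n" "D n 1", unfolded topspace_sub_preim] by simp
      then show ?thesis using F1 by auto
    qed
    moreover have "(?Z n closure_of (\<Union>k\<in>{0..2 ^ n - 2}. U n k)) \<inter> T = {}"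
    proof -
      have "{0..2 ^ n - 2} = {0..<2 ^ n - 1 :: nat}" using two by auto
      then have "(\<Union>k\<in>{0..2 ^ n - 2}. U n k) = D n (2 ^ n - 1)"
        using UN_chain_differences[of "2 ^ n" "L n" 0 "2 ^ n - 1"] L_mono two Llast L_ends
        by (simp add: U_def)
      then show ?thesis
        using T1 D(3)[OF n, of "2 ^ n - 1"] by (auto simp: closure_of_closedin)
    qed
    ultimately show ?thesis by blast
  qed
  ultimately show ?thesis by blast
qed

section \<open>The function of a consistent family\<close>

lemma consistent_partitions_coarsen:
  assumes c: "consistent_binary_partitions X Y f y N U" and "n \<le> m"
    and "j < 2 ^ m" "x \<in> U m j"
  shows "j div 2 ^ (m - n) < 2 ^ n \<and> x \<in> U n (j div 2 ^ (m - n))"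
  using \<open>n \<le> m\<close> \<open>j < 2 ^ m\<close> \<open>x \<in> U m j\<close>
proof (induction m arbitrary: j rule: dec_induct)
  case (step m)
  have "j div 2 < 2 ^ m" using step.prems by simp
  then have eq: "U (Suc m) (2 * (j div 2)) \<union> U (Suc m) (2 * (j div 2) + 1) =
      U m (j div 2) \<inter> preim X f (N (Suc m))"
    using c unfolding consistent_binary_partitions_def by blast
  have "j = 2 * (j div 2) \<or> j = 2 * (j div 2) + 1" by presburger
  then have "x \<in> U (Suc m) (2 * (j div 2)) \<union> U (Suc m) (2 * (j div 2) + 1)"
    using step.prems(2) by (metis UnCI)
  then have "x \<in> U m (j div 2)" using eq by blast
  from step.IH[OF \<open>j div 2 < 2 ^ m\<close> this] show ?case
    using step.hyps by (simp add: Suc_diff_le div_mult2_eq)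
qed simp

lemma regular_partition_unique:
  assumes "regular_partition Z K U" "i < K" "j < K" "x \<in> U i" "x \<in> U j"
  shows "i = j"
  using assms unfolding regular_partition_def disjoint_family_on_def
  by (metis IntI empty_iff lessThan_iff)

text \<open>Assign to \<open>U n k\<close> the dyadic interval from \<open>k / 2 ^ n\<close> to \<open>(k + 1) / 2 ^ n\<close>. By consistency the
  intervals assigned to the members that contain a fixed point are nested, so every left end is at most
  every right end.\<close>

lemma consistent_partitions_values_le:
  assumes c: "consistent_binary_partitions X Y f y N U"
    and k: "k < 2 ^ n" "x \<in> U n k" and j: "j < 2 ^ m" "x \<in> U m j"
  shows "real j / 2 ^ m \<le> (real k + 1) / 2 ^ n"
proof -
  have reg: "regular_partition (subtopology X (preim X f (N i))) (2 ^ i) (U i)" for i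
    using c unfolding consistent_binary_partitions_def by blast
  show ?thesis
  proof (cases "n \<le> m")
    case True
    then have "k = j div 2 ^ (m - n)"
      using regular_partition_unique[OF reg k(1) _ k(2)] consistent_partitions_coarsen[OF c True j]
      by blast
    then have "j < (k + 1) * 2 ^ (m - n)"
      by (metis Suc_eq_plus1 dividend_less_div_times mult_Suc plus_nat.add_0 zero_less_numeral
          zero_less_power add.commute)
    then have "real j < real ((k + 1) * 2 ^ (m - n))" by (simp only: of_nat_less_iff)
    then have "real j / 2 ^ m \<le> (real k + 1) * 2 ^ (m - n) / 2 ^ m"
      by (intro divide_right_mono) (simp_all add: algebra_simps)
    also have "\<dots> = (real k + 1) / 2 ^ n"
      using True by (simp add: power_diff)
    finally show ?thesis .
  next
    case False
    then have "m \<le> n" by simp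
    then have "j = k div 2 ^ (n - m)"
      using regular_partition_unique[OF reg j(1) _ j(2)] consistent_partitions_coarsen[OF c \<open>m \<le> n\<close> k]
      by blast
    then have "j * 2 ^ (n - m) \<le> k" by simp
    then have "real (j * 2 ^ (n - m)) \<le> real k" by (simp only: of_nat_le_iff)
    then have "real j * 2 ^ (n - m) / 2 ^ n \<le> (real k + 1) / 2 ^ n"
      by (simp add: divide_right_mono)
    moreover have "real j * 2 ^ (n - m) / 2 ^ n = real j / 2 ^ m"
      using \<open>m \<le> n\<close> by (simp add: power_diff)
    ultimately show ?thesis by simp
  qed
qed

text \<open>The analogue of Urysohn's function. For a point lying over all neighbourhoods of the family the
  nested dyadic intervals shrink to this value; for a point that drops out of the family after finitely
  many levels it is the left end of the smallest of its intervals.\<close>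

definition partition_function :: "(nat \<Rightarrow> nat \<Rightarrow> 'a set) \<Rightarrow> 'a \<Rightarrow> real" where
  "partition_function U x = (SUP (n, k) \<in> {(n, k). k < 2 ^ n \<and> x \<in> U n k}. real k / 2 ^ n)"

lemma partition_function_bounds:
  assumes c: "consistent_binary_partitions X Y f y N U" and k: "k < 2 ^ n" "x \<in> U n k"
  shows "real k / 2 ^ n \<le> partition_function U x" "partition_function U x \<le> (real k + 1) / 2 ^ n"
proof -
  have bound: "(\<lambda>(n, k). real k / 2 ^ n) p \<le> (real k + 1) / 2 ^ n"
    if "p \<in> {(n, k). k < 2 ^ n \<and> x \<in> U n k}" for p
    using consistent_partitions_values_le[OF c k] that by auto
  have mem: "(n, k) \<in> {(n, k). k < 2 ^ n \<and> x \<in> U n k}" using k by simp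
  show "partition_function U x \<le> (real k + 1) / 2 ^ n"
    unfolding partition_function_def using mem bound by (intro cSUP_least) auto
  show "real k / 2 ^ n \<le> partition_function U x"
  proof -
    have "bdd_above ((\<lambda>(n, k). real k / 2 ^ n) ` {(n, k). k < 2 ^ n \<and> x \<in> U n k})"
      using bound by (rule bdd_aboveI2)
    from cSUP_upper[OF mem this] show ?thesis unfolding partition_function_def by simp
  qed
qed

lemma partition_function_eq_0:
  assumes "\<And>n k. k < 2 ^ n \<Longrightarrow> x \<in> U n k \<Longrightarrow> k = 0" and "x \<in> U 0 0"
  shows "partition_function U x = 0"
proof -
  have "(0, 0) \<in> {(n, k). k < 2 ^ n \<and> x \<in> U n k}" using assms(2) by simp
  moreover have "(\<lambda>(n, k). real k / 2 ^ n) p = (0 :: real)"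
    if "p \<in> {(n, k). k < 2 ^ n \<and> x \<in> U n k}" for p
    using that assms(1) by auto
  ultimately have "(\<lambda>(n, k). real k / 2 ^ n) ` {(n, k). k < 2 ^ n \<and> x \<in> U n k} = {0 :: real}"
    by (metis (no_types, lifting) image_cong image_constant)
  then show ?thesis unfolding partition_function_def by simp
qed

lemma consistent_partitions_cover:
  assumes "consistent_binary_partitions X Y f y N U" "x \<in> preim X f (N n)"
  obtains k where "k < 2 ^ n" "x \<in> U n k"
proof -
  have "(\<Union>k<2 ^ n. U n k) = preim X f (N n)"
    using assms(1) unfolding consistent_binary_partitions_def regular_partition_def
    by (metis topspace_sub_preim)
  then show ?thesis using assms(2) that by blast
qed

lemma consistent_partitions_subset:
  assumes "consistent_binary_partitions X Y f y N U" "k < 2 ^ n"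
  shows "U n k \<subseteq> preim X f (N n)"
proof -
  have "(\<Union>k<2 ^ n. U n k) = preim X f (N n)"
    using assms(1) unfolding consistent_binary_partitions_def regular_partition_def
    by (metis topspace_sub_preim)
  then show ?thesis using assms(2) by blast
qed

text \<open>By regularity a point of \<open>U n k\<close> has a neighbourhood that meets only the members with indices
  \<open>k - 1\<close>, \<open>k\<close>, \<open>k + 1\<close>; the value intervals of these members lie within \<open>2 / 2 ^ n\<close> of any value
  taken on \<open>U n k\<close>.\<close>

lemma partition_function_osc_within:
  assumes c: "consistent_binary_partitions X Y f y N U" and f: "continuous_map X Y f"
  shows "osc_within X (partition_function U) (2 / 2 ^ n) (preim X f (N n))"
  unfolding osc_within_def
proof
  let ?P = "preim X f (N n)" and ?Z = "subtopology X (preim X f (N n))"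
  fix x assume x: "x \<in> ?P"
  obtain k where k: "k < 2 ^ n" "x \<in> U n k"
    using consistent_partitions_cover[OF c x] .
  have reg: "regular_partition ?Z (2 ^ n) (U n)" and NY: "openin Y (N n)"
    using c unfolding consistent_binary_partitions_def by blast+
  \<comment> \<open>The neighbourhood of \<open>x\<close> is the complement of the lower members \<open>A\<close>, which form a closed set,
    and of the closure of the upper members \<open>B\<close>. The index set of \<open>A\<close> avoids the truncated difference
    \<open>k - 2\<close>.\<close>
  define A where "A = (\<Union>m\<in>{m. m + 2 \<le> k}. U n m)"
  define B where "B = (\<Union>m\<in>{k + 2..2 ^ n - 1}. U n m)"
  have "closedin ?Z A"
  proof (cases "k \<ge> 2")
    case True
    then have "{m. m + 2 \<le> k} = {..k - 2}" by auto
    then show ?thesis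
      using reg k(1) unfolding regular_partition_def A_def by simp
  qed (simp add: A_def)
  moreover have "x \<notin> A"
  proof
    assume "x \<in> A"
    then obtain m where "m + 2 \<le> k" "x \<in> U n m" by (auto simp: A_def)
    then show False using regular_partition_unique[OF reg k(1) _ k(2), of m] k(1) by simp
  qed
  moreover have "x \<notin> ?Z closure_of B"
  proof (cases "k + 2 \<le> 2 ^ n - 1")
    case True
    then have "3 \<le> (2::nat) ^ n" "k \<le> 2 ^ n - 3" by auto
    then have "(\<Union>m\<le>k. U n m) \<inter> ?Z closure_of B = {}"
      using reg unfolding regular_partition_def B_def by blast
    then show ?thesis using k by blast
  next
    case False
    then have "B = {}" by (auto simp: B_def)
    then show ?thesis by simp
  qed
  ultimately have "openin ?Z (?P - A - ?Z closure_of B)" and xO: "x \<in> ?P - A - ?Z closure_of B"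
    using openin_diff[OF openin_diff[OF openin_topspace] closedin_closure_of, of ?Z A B] x
    by (simp_all only: topspace_sub_preim Diff_iff simp_thms)
  then have O: "openin X (?P - A - ?Z closure_of B)"
    using openin_trans_full[OF _ openin_preim[OF f NY]] by blast
  have "\<bar>partition_function U x - partition_function U z\<bar> \<le> 2 / 2 ^ n"
    if "z \<in> ?P - A - ?Z closure_of B" for z
  proof -
    have "z \<in> ?P" using that by simp
    then obtain l where l: "l < 2 ^ n" "z \<in> U n l"
      by (rule consistent_partitions_cover[OF c])
    have "k < l + 2" using that l by (force simp: A_def)
    have "l < k + 2"
    proof (rule ccontr)
      assume "\<not> l < k + 2"
      then have "z \<in> B" using l by (auto simp: B_def)
      moreover have "B \<subseteq> topspace ?Z"
        unfolding topspace_sub_preim B_def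
        by (intro UN_least consistent_partitions_subset[OF c]) (use k in auto)
      ultimately show False using that closure_of_subset by blast
    qed
    have "(real k - 1) / 2 ^ n \<le> real l / 2 ^ n" "(real l - 1) / 2 ^ n \<le> real k / 2 ^ n"
      using \<open>k < l + 2\<close> \<open>l < k + 2\<close> by (auto simp: divide_right_mono)
    with partition_function_bounds[OF c k] partition_function_bounds[OF c l] show ?thesis
      by (simp add: add_divide_distrib diff_divide_distrib abs_le_iff)
  qed
  with O xO show "\<exists>V. openin X V \<and> x \<in> V \<and>
      (\<forall>z\<in>V. \<bar>partition_function U x - partition_function U z\<bar> \<le> 2 / 2 ^ n)"
    by blast
qed

lemma partition_function_map_continuous_at:
  assumes c: "consistent_binary_partitions X Y f y N U" and f: "continuous_map X Y f"
  shows "map_continuous_at X Y f (partition_function U) y"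
    and "\<And>x. x \<in> topspace X \<Longrightarrow> 0 \<le> partition_function U x \<and> partition_function U x \<le> 1"
proof -
  have N: "N 0 = topspace Y" "\<And>n. openin Y (N n) \<and> y \<in> N n"
    using c unfolding consistent_binary_partitions_def by blast+
  show range: "0 \<le> partition_function U x \<and> partition_function U x \<le> 1"
    if x: "x \<in> topspace X" for x
  proof -
    have "x \<in> preim X f (N 0)"
      using x f N(1) by (auto simp: continuous_map_def)
    then obtain k where "k < 2 ^ 0" "x \<in> U 0 k"
      using consistent_partitions_cover[OF c] by blast
    then show ?thesis using partition_function_bounds[OF c, of k 0 x] by simp
  qed
  show "map_continuous_at X Y f (partition_function U) y"
    unfolding map_continuous_at_iff
  proof (intro conjI allI impI)
    show "bounded (partition_function U ` topspace X)"
      unfolding bounded_real using range by (intro exI[of _ 1]) auto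
    fix e :: real assume "e > 0"
    then obtain n where "(1 / 2) ^ n < e / 2"
      using real_arch_pow_inv[of "e / 2" "1 / 2"] by auto
    then have "2 / 2 ^ n \<le> e" by (simp add: power_one_over)
    then show "\<exists>W. openin Y W \<and> y \<in> W \<and> osc_within X (partition_function U) e (preim X f W)"
      using N(2)[of n] osc_within_mono[OF partition_function_osc_within[OF c f, of n] subset_refl]
      by blast
  qed
qed

text \<open>On \<open>T\<close> the function \<open>partition_function U\<close> is only close to \<open>1\<close>, because a point outside some
  neighbourhood of the family gets the left end of its interval. Doubling and truncating at \<open>1\<close> corrects
  this and keeps the value \<open>0\<close> on \<open>F\<close>. Level \<open>4\<close> is fine enough: doubled, the oscillation is at
  most \<open>4 / 16\<close>, the value is below \<open>1 / 2\<close> on \<open>U 4 0\<close> and equal to \<open>1\<close> on \<open>U 4 15\<close>.\<close>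

lemma urysohn_of_consistent_partitions:
  assumes c: "consistent_binary_partitions X Y f y N U" and f: "continuous_map X Y f"
    and sep: "\<forall>n\<ge>1.
             F \<inter> preim X f (N n) \<subseteq> U n 0 \<and>
             T \<inter> preim X f (N n) \<subseteq> U n (2 ^ n - 1) \<and>
             F \<inter> (subtopology X (preim X f (N n)) closure_of (\<Union>k\<in>{1..2 ^ n - 1}. U n k)) = {} \<and>
             (subtopology X (preim X f (N n)) closure_of (\<Union>k\<in>{0..2 ^ n - 2}. U n k)) \<inter> T = {}"
  shows "\<exists>\<phi> :: 'a \<Rightarrow> real. \<exists>V.
           \<phi> ` topspace X \<subseteq> {0..1} \<and> map_continuous_at X Y f \<phi> y \<and>
           openin Y V \<and> y \<in> V \<and>
           osc_on X \<phi> (preim X f V) < 1 / 2 \<and>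
           F \<inter> preim X f V \<subseteq> preim X \<phi> {0} \<inter> preim X f V \<and>
           T \<inter> preim X f V \<subseteq> preim X \<phi> {1} \<inter> preim X f V \<and>
           F \<inter> preim X f V \<subseteq>
             preim X f V -
               (subtopology X (preim X f V) closure_of (preim X \<phi> {1 / 2..1} \<inter> preim X f V)) \<and>
           T \<inter> preim X f V \<subseteq>
             subtopology X (preim X f V) interior_of (preim X \<phi> {1 / 2..1} \<inter> preim X f V)"
proof -
  define g where "g = partition_function U"
  define \<phi> where "\<phi> x = min 1 (2 * g x)" for x
  let ?P = "preim X f (N 4)" and ?Z = "subtopology X (preim X f (N 4))"
  note g_bounds = partition_function_bounds[OF c, folded g_def]
  have g_range: "0 \<le> g x \<and> g x \<le> 1" if "x \<in> topspace X" for x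
    using partition_function_map_continuous_at(2)[OF c f that] by (simp add: g_def)
  have reg: "regular_partition (subtopology X (preim X f (N n))) (2 ^ n) (U n)" for n
    using c unfolding consistent_binary_partitions_def by blast
  have N: "N 0 = topspace Y" "openin Y (N 4)" "y \<in> N 4"
    using c unfolding consistent_binary_partitions_def by blast+
  have lip: "\<bar>min 1 (2 * u) - min 1 (2 * v)\<bar> \<le> 2 * \<bar>u - v\<bar>" for u v :: real
    by (simp add: min_def abs_if)
  have cont: "map_continuous_at X Y f \<phi> y"
    unfolding \<phi>_def
    by (rule map_continuous_at_lipschitz[where L = 2, OF _ _ lip])
      (simp_all add: g_def partition_function_map_continuous_at[OF c f])
  have range: "\<phi> ` topspace X \<subseteq> {0..1}"
    using g_range by (auto simp: \<phi>_def)
  have osc_g: "osc_within X g (1 / 8) ?P"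
    using partition_function_osc_within[OF c f, of 4] by (simp add: g_def)
  have "osc_within X \<phi> (1 / 4) ?P"
    unfolding osc_within_def
  proof
    fix x assume "x \<in> ?P"
    then obtain G where G: "openin X G" "x \<in> G" "\<And>z. z \<in> G \<Longrightarrow> \<bar>g x - g z\<bar> \<le> 1 / 8"
      using osc_g unfolding osc_within_def by meson
    have "\<bar>\<phi> x - \<phi> z\<bar> \<le> 1 / 4" if "z \<in> G" for z
      using lip[of "g x" "g z"] G(3)[OF that] unfolding \<phi>_def by linarith
    with G show "\<exists>G. openin X G \<and> x \<in> G \<and> (\<forall>z\<in>G. \<bar>\<phi> x - \<phi> z\<bar> \<le> 1 / 4)" by blast
  qed
  then have osc: "osc_on X \<phi> ?P < 1 / 2"
    using osc_on_le[of \<phi> X "1 / 4" ?P] cont by (simp add: map_continuous_at_iff)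
  have F0: "\<phi> x = 0" if "x \<in> F \<inter> ?P" for x
  proof -
    have "x \<in> preim X f (N 0)"
      using that f N(1) by (auto simp: continuous_map_def)
    then obtain k0 where "k0 < 2 ^ 0" "x \<in> U 0 k0"
      using consistent_partitions_cover[OF c] by blast
    moreover have "k = 0" if k: "k < 2 ^ n" "x \<in> U n k" for n k
    proof (cases "n \<ge> 1")
      case True
      then have "x \<in> U n 0"
        using sep[rule_format, OF True] consistent_partitions_subset[OF c k(1)] k(2) \<open>x \<in> F \<inter> ?P\<close> by blast
      then show ?thesis using regular_partition_unique[OF reg k(1) _ k(2)] by simp
    next
      case False
      then have "n = 0" by simp
      then show ?thesis using k by simp
    qed
    ultimately show ?thesis
      using partition_function_eq_0[of x U] by (simp add: \<phi>_def g_def)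
  qed
  have last1: "\<phi> x = 1" if "x \<in> U 4 15" for x
    using g_bounds(1)[of 15 4 x] that by (simp add: \<phi>_def)
  have sep4: "T \<inter> ?P \<subseteq> U 4 15" "F \<inter> ?Z closure_of (\<Union>k\<in>{1..15}. U 4 k) = {}"
    "?Z closure_of (\<Union>k\<in>{0..14}. U 4 k) \<inter> T = {}"
    using sep[rule_format, of 4] by simp_all
  have "preim X \<phi> {1 / 2..1} \<inter> ?P \<subseteq> (\<Union>k\<in>{1..15}. U 4 k)"
  proof
    fix x assume x: "x \<in> preim X \<phi> {1 / 2..1} \<inter> ?P"
    then obtain k where k: "k < 2 ^ 4" "x \<in> U 4 k"
      using consistent_partitions_cover[OF c, of x 4] by blast
    have "1 / 4 \<le> g x" using x by (auto simp: \<phi>_def min_def split: if_splits)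
    with g_bounds(2)[OF k] have "k \<ge> 1" by (cases k) auto
    with k show "x \<in> (\<Union>k\<in>{1..15}. U 4 k)" by auto
  qed
  then have "F \<inter> ?Z closure_of (preim X \<phi> {1 / 2..1} \<inter> ?P) = {}"
    using closure_of_mono[of _ _ ?Z] sep4(2) by blast
  moreover have "T \<inter> ?P \<subseteq> ?Z interior_of (preim X \<phi> {1 / 2..1} \<inter> ?P)"
  proof -
    let ?G = "?P - ?Z closure_of (\<Union>k\<in>{0..14}. U 4 k)"
    have "openin ?Z ?G"
      using openin_diff[OF openin_topspace closedin_closure_of, of ?Z] by (simp only: topspace_sub_preim)
    moreover have "?G \<subseteq> preim X \<phi> {1 / 2..1} \<inter> ?P"
    proof
      fix x assume x: "x \<in> ?G"
      then obtain k where k: "k < 2 ^ 4" "x \<in> U 4 k"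
        using consistent_partitions_cover[OF c, of x 4] by blast
      have "(\<Union>k\<in>{0..14}. U 4 k) \<subseteq> topspace ?Z"
        unfolding topspace_sub_preim by (intro UN_least consistent_partitions_subset[OF c]) auto
      then have "x \<notin> (\<Union>k\<in>{0..14}. U 4 k)" using x closure_of_subset by blast
      then have "k = 15" using k by force
      then show "x \<in> preim X \<phi> {1 / 2..1} \<inter> ?P" using x k last1 by auto
    qed
    ultimately have "?G \<subseteq> ?Z interior_of (preim X \<phi> {1 / 2..1} \<inter> ?P)"
      by (intro interior_of_maximal)
    then show ?thesis using sep4(3) by blast
  qed
  moreover have "F \<inter> ?P \<subseteq> preim X \<phi> {0} \<inter> ?P" "T \<inter> ?P \<subseteq> preim X \<phi> {1} \<inter> ?P"
    using F0 last1 sep4(1) by auto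
  ultimately show ?thesis
    using cont range osc N by (intro exI[of _ \<phi>] exI[of _ "N 4"]) blast
qed

section \<open>From normality to partitions and functions\<close>

lemma normal_map_imp_consistent_partitions:
  assumes f: "continuous_map X Y f" and n: "normal_map X Y f"
    and W: "openin Y W" "y \<in> W"
    and F: "closedin (subtopology X (preim X f W)) F"
    and T: "closedin (subtopology X (preim X f W)) T" and "F \<inter> T = {}"
  shows "\<exists>N U. consistent_binary_partitions X Y f y N U \<and>
          (\<forall>n\<ge>1.
             F \<inter> preim X f (N n) \<subseteq> U n 0 \<and>
             T \<inter> preim X f (N n) \<subseteq> U n (2 ^ n - 1) \<and>
             F \<inter> (subtopology X (preim X f (N n)) closure_of (\<Union>k\<in>{1..2 ^ n - 1}. U n k)) = {} \<and>
             (subtopology X (preim X f (N n)) closure_of (\<Union>k\<in>{0..2 ^ n - 2}. U n k)) \<inter> T = {})"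
proof (rule normal_map_imp_separating_chains[OF f n W F T \<open>F \<inter> T = {}\<close>])
  fix V D
  assume "\<And>n. openin Y (V n)" "\<And>n. y \<in> V n" "\<And>n. V (Suc n) \<subseteq> V n"
    "\<And>n. separating_chain X (preim X f (V n)) F T n (D n)"
    "\<And>n i. i \<le> 2 ^ n \<Longrightarrow> D (Suc n) (2 * i) = D n i \<inter> preim X f (V (Suc n))"
  then show ?thesis by (rule consistent_partitions_of_separating_chains[OF _ _ _ _ _ f])
qed

lemma normal_map_imp_urysohn:
  assumes f: "continuous_map X Y f" and n: "normal_map X Y f"
    and W: "openin Y W" "y \<in> W"
    and F: "closedin (subtopology X (preim X f W)) F"
    and T: "closedin (subtopology X (preim X f W)) T" and "F \<inter> T = {}"
  obtains \<phi> V where "\<phi> ` topspace X \<subseteq> {0..1 :: real}" "map_continuous_at X Y f \<phi> y"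
    "openin Y V" "y \<in> V" "\<forall>x\<in>F \<inter> preim X f V. \<phi> x = 0"
    "\<forall>x\<in>T \<inter> preim X f V. \<phi> x = 1"
proof -
  obtain N U where c: "consistent_binary_partitions X Y f y N U" and sep: "\<forall>n\<ge>1.
             F \<inter> preim X f (N n) \<subseteq> U n 0 \<and>
             T \<inter> preim X f (N n) \<subseteq> U n (2 ^ n - 1) \<and>
             F \<inter> (subtopology X (preim X f (N n)) closure_of (\<Union>k\<in>{1..2 ^ n - 1}. U n k)) = {} \<and>
             (subtopology X (preim X f (N n)) closure_of (\<Union>k\<in>{0..2 ^ n - 2}. U n k)) \<inter> T = {}"
    using normal_map_imp_consistent_partitions[OF f n W F T \<open>F \<inter> T = {}\<close>] by (elim exE conjE)
  from urysohn_of_consistent_partitions[OF c f sep]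
  obtain \<phi> :: "'a \<Rightarrow> real" and V where "\<phi> ` topspace X \<subseteq> {0..1}" "map_continuous_at X Y f \<phi> y"
    "openin Y V" "y \<in> V" "F \<inter> preim X f V \<subseteq> preim X \<phi> {0} \<inter> preim X f V"
    "T \<inter> preim X f V \<subseteq> preim X \<phi> {1} \<inter> preim X f V"
    by (elim exE conjE)
  then show thesis by (intro that[of \<phi> V]) blast+
qed

text \<open>The interior of a set is disjoint from the complement of its closure.\<close>

lemma separation_of_interior_closure:
  assumes f: "continuous_map X Y f" and W: "openin Y W" "y \<in> W" and V: "openin Y V" "y \<in> V"
    and F: "F \<inter> preim X f V \<subseteq> preim X f V - (subtopology X (preim X f V) closure_of E)"
    and T: "T \<inter> preim X f V \<subseteq> subtopology X (preim X f V) interior_of E"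
  shows "\<exists>V S S'. openin Y V \<and> y \<in> V \<and> V \<subseteq> W \<and> openin X S \<and> openin X S' \<and>
         F \<inter> preim X f V \<subseteq> S \<and> T \<inter> preim X f V \<subseteq> S' \<and> S \<inter> S' = {}"
proof -
  let ?Z = "subtopology X (preim X f V)"
  have openX: "openin X S" if "openin ?Z S" for S
    using openin_trans_full[OF that openin_preim[OF f V(1)]] .
  show ?thesis
  proof (intro exI conjI)
    show "openin Y (V \<inter> W)" "y \<in> V \<inter> W" "V \<inter> W \<subseteq> W" using V W by auto
    have "openin ?Z (preim X f V - ?Z closure_of E)"
      using openin_diff[OF openin_topspace closedin_closure_of, of ?Z] by (simp only: topspace_sub_preim)
    then show "openin X (preim X f V - ?Z closure_of E)" by (rule openX)
    show "openin X (?Z interior_of E)" by (rule openX) simp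
    show "F \<inter> preim X f (V \<inter> W) \<subseteq> preim X f V - ?Z closure_of E" using F by blast
    show "T \<inter> preim X f (V \<inter> W) \<subseteq> ?Z interior_of E" using T by blast
    show "(preim X f V - ?Z closure_of E) \<inter> ?Z interior_of E = {}"
      using interior_of_subset_closure_of[of ?Z E] by blast
  qed
qed

section \<open>Extension of functions\<close>

lemma sup_norm_upper:
  fixes \<phi> :: "'a \<Rightarrow> real"
  assumes "bounded (\<phi> ` A)" "x \<in> A"
  shows "\<bar>\<phi> x\<bar> \<le> sup_norm A \<phi>"
proof -
  obtain M where "\<And>x. x \<in> A \<Longrightarrow> \<bar>\<phi> x\<bar> \<le> M"
    using assms(1) by (rule bounded_imageE) blast
  then have "bdd_above ((\<lambda>x. \<bar>\<phi> x\<bar>) ` A)" by (rule bdd_aboveI2)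
  then show ?thesis
    unfolding sup_norm_def using assms(2) by (auto intro: cSUP_upper)
qed

lemma sup_norm_le:
  assumes "\<And>x. x \<in> A \<Longrightarrow> \<bar>\<phi> x\<bar> \<le> c" "0 \<le> c"
  shows "sup_norm A \<phi> \<le> c"
  unfolding sup_norm_def using assms by (auto intro!: cSUP_least)

lemma map_continuous_at_subspace:
  assumes s: "map_continuous_at X Y f s y" and W: "openin Y W" "y \<in> W"
  shows "map_continuous_at (subtopology X F) (subtopology Y W) f s y"
  unfolding map_continuous_at_iff
proof (intro conjI allI impI)
  have "bounded (s ` topspace X)" using s unfolding map_continuous_at_iff by blast
  then show "bounded (s ` topspace (subtopology X F))"
    by (rule bounded_subset) (auto simp: topspace_subtopology)
  fix e :: real assume "e > 0"
  then obtain V where V: "openin Y V" "y \<in> V" "osc_within X s e (preim X f V)"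
    using s unfolding map_continuous_at_iff by blast
  have "osc_within (subtopology X F) s e (preim (subtopology X F) f (V \<inter> W))"
    unfolding osc_within_def
  proof
    fix x assume "x \<in> preim (subtopology X F) f (V \<inter> W)"
    then have "x \<in> preim X f V" "x \<in> F" by (auto simp: topspace_subtopology)
    then obtain U where U: "openin X U" "x \<in> U" "\<forall>z\<in>U. \<bar>s x - s z\<bar> \<le> e"
      using V(3) unfolding osc_within_def by blast
    then show "\<exists>U. openin (subtopology X F) U \<and> x \<in> U \<and> (\<forall>z\<in>U. \<bar>s x - s z\<bar> \<le> e)"
      using \<open>x \<in> F\<close> openin_subtopology_Int[OF U(1), of F] by (intro exI[of _ "U \<inter> F"]) auto
  qed
  moreover have "openin (subtopology Y W) (V \<inter> W)" using V(1) by (rule openin_subtopology_Int)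
  ultimately show "\<exists>V. openin (subtopology Y W) V \<and> y \<in> V \<and>
      osc_within (subtopology X F) s e (preim (subtopology X F) f V)"
    using V(2) W(2) by blast
qed

text \<open>One step of Tietze's construction. The sets where \<open>g\<close> is at least \<open>r / 3\<close> and at most \<open>- r / 3\<close>
  need not be closed, as \<open>g\<close> need not be continuous. Over a neighbourhood where the oscillation of
  \<open>g\<close> is at most \<open>r / 4\<close> a common point of their closures would give a value of \<open>g\<close> that is both
  positive and negative, so the closures are disjoint and a Urysohn function applies to them.\<close>

lemma map_continuous_at_approximation:
  assumes f: "continuous_map X Y f" and n: "normal_map X Y f"
    and W: "openin Y W" "y \<in> W" and F: "closedin (subtopology X (preim X f W)) F"
    and g: "map_continuous_at (subtopology X F) (subtopology Y W) f g y"
    and V: "openin Y V" "y \<in> V" "V \<subseteq> W" and "r > 0"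
    and bound: "\<And>x. x \<in> F \<inter> preim X f V \<Longrightarrow> \<bar>g x\<bar> \<le> r"
  obtains V' h where "openin Y V'" "y \<in> V'" "V' \<subseteq> V" "map_continuous_at X Y f h y"
    "\<forall>x\<in>topspace X. \<bar>h x\<bar> \<le> r / 3"
    "\<forall>x\<in>F \<inter> preim X f V'. \<bar>g x - h x\<bar> \<le> 2 * r / 3"
proof -
  have "r / 4 > 0" using \<open>r > 0\<close> by simp
  then obtain V1 where V1: "openin (subtopology Y W) V1" "y \<in> V1"
    "osc_within (subtopology X F) g (r / 4) (preim (subtopology X F) f V1)"
    using g unfolding map_continuous_at_iff by blast
  define V2 where "V2 = V \<inter> V1"
  have "openin Y V1" using openin_trans_full[OF V1(1) W(1)] .
  then have V2: "openin Y V2" "y \<in> V2" "V2 \<subseteq> V" "V2 \<subseteq> V1" using V V1 by (auto simp: V2_def)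
  let ?P = "preim X f V2" and ?Z = "subtopology X (preim X f V2)"
  have "?P \<subseteq> preim X f W" using V2 V by auto
  then have FP: "closedin ?Z (F \<inter> ?P)" using closedin_sub_restrict[OF F] by blast
  define A where "A = {x \<in> F \<inter> ?P. g x \<ge> r / 3}"
  define B where "B = {x \<in> F \<inter> ?P. g x \<le> - r / 3}"
  have AB: "A \<subseteq> F \<inter> ?P" "B \<subseteq> F \<inter> ?P" by (auto simp: A_def B_def)
  have "?Z closure_of B \<inter> ?Z closure_of A = {}"
  proof (rule Int_emptyI)
    fix x assume xB: "x \<in> ?Z closure_of B" and x: "x \<in> ?Z closure_of A"
    have "x \<in> F \<inter> ?P" using closure_of_minimal[OF AB(1) FP] x by blast
    then have "x \<in> preim (subtopology X F) f V1" using V2 by (auto simp: topspace_subtopology)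
    then obtain U where "openin (subtopology X F) U" "x \<in> U" "\<forall>z\<in>U. \<bar>g x - g z\<bar> \<le> r / 4"
      using V1(3) unfolding osc_within_def by blast
    then obtain U where U: "openin X U" "x \<in> U" "\<And>z. z \<in> U \<inter> F \<Longrightarrow> \<bar>g x - g z\<bar> \<le> r / 4"
      unfolding openin_subtopology by blast
    have nbhd: "x \<in> U \<inter> ?P \<and> openin ?Z (U \<inter> ?P)"
      using U(2) \<open>x \<in> F \<inter> ?P\<close> openin_subtopology_Int[OF U(1)] by simp
    have meets: "\<exists>c. c \<in> C \<and> c \<in> U \<inter> ?P" if "x \<in> ?Z closure_of C" for C
      by (rule that[unfolded in_closure_of, THEN conjunct2, THEN spec, THEN mp, OF nbhd])
    obtain a where "a \<in> A \<and> a \<in> U \<inter> ?P" using meets[OF x] by (rule exE)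
    moreover obtain b where "b \<in> B \<and> b \<in> U \<inter> ?P" using meets[OF xB] by (rule exE)
    ultimately have "\<bar>g x - g a\<bar> \<le> r / 4" "\<bar>g x - g b\<bar> \<le> r / 4" "g a \<ge> r / 3" "g b \<le> - r / 3"
      using U(3) by (auto simp: A_def B_def)
    with \<open>r > 0\<close> show False by linarith
  qed
  then obtain \<phi> :: "'a \<Rightarrow> real" and V3 where \<phi>: "\<phi> ` topspace X \<subseteq> {0..1}" "map_continuous_at X Y f \<phi> y"
    and V3: "openin Y V3" "y \<in> V3"
    and vals: "\<forall>x\<in>?Z closure_of B \<inter> preim X f V3. \<phi> x = 0"
      "\<forall>x\<in>?Z closure_of A \<inter> preim X f V3. \<phi> x = 1"
    by (rule normal_map_imp_urysohn[OF f n V2(1,2) closedin_closure_of closedin_closure_of])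
  define h where "h x = r / 3 * (2 * \<phi> x - 1)" for x
  show thesis
  proof
    show "openin Y (V2 \<inter> V3)" "y \<in> V2 \<inter> V3" "V2 \<inter> V3 \<subseteq> V" using V2 V3 by auto
    have "\<bar>r / 3 * (2 * u - 1) - r / 3 * (2 * v - 1)\<bar> \<le> 2 * r / 3 * \<bar>u - v\<bar>" for u v
    proof -
      have eq: "r / 3 * (2 * u - 1) - r / 3 * (2 * v - 1) = 2 * r / 3 * (u - v)"
        by (simp add: algebra_simps)
      show ?thesis unfolding eq using \<open>r > 0\<close> by (simp add: abs_mult)
    qed
    then show "map_continuous_at X Y f h y"
      unfolding h_def using \<open>r > 0\<close>
      by (intro map_continuous_at_lipschitz[OF \<phi>(2), where L = "2 * r / 3"]) auto
    have h_range: "\<bar>h x\<bar> \<le> r / 3" if "x \<in> topspace X" for x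
    proof -
      have "\<bar>2 * \<phi> x - 1\<bar> \<le> 1" using \<phi>(1) that by force
      then have "r / 3 * \<bar>2 * \<phi> x - 1\<bar> \<le> r / 3 * 1"
        using \<open>r > 0\<close> by (intro mult_left_mono) auto
      then show ?thesis using \<open>r > 0\<close> by (simp add: h_def abs_mult)
    qed
    then show "\<forall>x\<in>topspace X. \<bar>h x\<bar> \<le> r / 3" by blast
    have "\<bar>g x - h x\<bar> \<le> 2 * r / 3" if x: "x \<in> F \<inter> preim X f (V2 \<inter> V3)" for x
    proof -
      have gx: "\<bar>g x\<bar> \<le> r" using bound V2 x by blast
      have hx: "\<bar>h x\<bar> \<le> r / 3" using h_range x by blast
      have sub: "A \<subseteq> ?Z closure_of A" "B \<subseteq> ?Z closure_of B"
        using AB by (auto intro!: closure_of_subset simp: topspace_subtopology)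
      consider "g x \<ge> r / 3" | "g x \<le> - r / 3" | "\<bar>g x\<bar> < r / 3" by linarith
      then show ?thesis
      proof cases
        case 1
        then have "x \<in> ?Z closure_of A" using x sub by (auto simp: A_def)
        then have "h x = r / 3" using vals(2) x by (simp add: h_def)
        then show ?thesis using gx 1 by linarith
      next
        case 2
        then have "x \<in> ?Z closure_of B" using x sub by (auto simp: B_def)
        then have "h x = - (r / 3)" using vals(1) x by (simp add: h_def)
        then show ?thesis using gx 2 by linarith
      next
        case 3
        then show ?thesis using hx by linarith
      qed
    qed
    then show "\<forall>x\<in>F \<inter> preim X f (V2 \<inter> V3). \<bar>g x - h x\<bar> \<le> 2 * r / 3" by blast
  qed
qed

lemma map_continuous_at_zero:
  assumes "openin Y W" "y \<in> W"
  shows "map_continuous_at X Y f (\<lambda>x. 0) y"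
  unfolding map_continuous_at_iff osc_within_def
proof (intro conjI allI impI)
  show "bounded ((\<lambda>x. 0) ` topspace X :: real set)" unfolding bounded_real by auto
  show "\<exists>W. openin Y W \<and> y \<in> W \<and> (\<forall>x\<in>preim X f W. \<exists>U. openin X U \<and> x \<in> U \<and>
      (\<forall>z\<in>U. \<bar>(0::real) - 0\<bar> \<le> e))" if "e > 0" for e
    using assms that openin_topspace[of X] by (intro exI[of _ W]) auto
qed

text \<open>The bound on all of \<open>X\<close> follows from the sum of the geometric increments, while the approximation
  holds only over neighbourhoods \<open>V n\<close> that depend on the level.\<close>

lemma tietze_approximating_sequence:
  assumes f: "continuous_map X Y f" and n: "normal_map X Y f"
    and W: "openin Y W" "y \<in> W" and F: "closedin (subtopology X (preim X f W)) F"
    and \<psi>: "map_continuous_at (subtopology X F) (subtopology Y W) f \<psi> y"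
    and "M > 0" and bound: "\<And>x. x \<in> F \<Longrightarrow> \<bar>\<psi> x\<bar> \<le> M"
  obtains s V where "\<forall>n. map_continuous_at X Y f (s n) y"
    "\<forall>n. openin Y (V n) \<and> y \<in> V n \<and> V n \<subseteq> W"
    "\<forall>n. \<forall>x\<in>topspace X. \<bar>s n x\<bar> \<le> M"
    "\<forall>n. \<forall>x\<in>F \<inter> preim X f (V n). \<bar>\<psi> x - s n x\<bar> \<le> M * (2 / 3) ^ n"
    "\<forall>n. \<forall>x\<in>topspace X. \<bar>s (Suc n) x - s n x\<bar> \<le> M * (2 / 3) ^ n / 3"
proof -
  define P where "P = (\<lambda>n (s, V). map_continuous_at X Y f s y \<and> openin Y V \<and> y \<in> V \<and> V \<subseteq> W \<and>
    (\<forall>x\<in>topspace X. \<bar>s x\<bar> \<le> M * (1 - (2 / 3) ^ n)) \<and>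
    (\<forall>x\<in>F \<inter> preim X f V. \<bar>\<psi> x - s x\<bar> \<le> M * (2 / 3) ^ n))"
  define Q where "Q = (\<lambda>n (s, V :: 'b set) (s', V' :: 'b set).
    \<forall>x\<in>topspace X. \<bar>s' x - s x\<bar> \<le> M * (2 / 3) ^ n / 3)"
  have "\<exists>t. P 0 t"
    using W bound map_continuous_at_zero[OF W]
    by (intro exI[of _ "(\<lambda>x. 0, W)"]) (simp add: P_def)
  moreover have "\<exists>t'. P (Suc n) t' \<and> Q n t t'" if Pt: "P n t" for n t
  proof -
    obtain s V where t: "t = (s, V)" by fastforce
    with Pt have s: "map_continuous_at X Y f s y" and V: "openin Y V" "y \<in> V" "V \<subseteq> W"
      and range: "\<And>x. x \<in> topspace X \<Longrightarrow> \<bar>s x\<bar> \<le> M * (1 - (2 / 3) ^ n)"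
      and err: "\<And>x. x \<in> F \<inter> preim X f V \<Longrightarrow> \<bar>\<psi> x - s x\<bar> \<le> M * (2 / 3) ^ n"
      by (auto simp: P_def)
    have "map_continuous_at X Y f (\<lambda>x. - s x) y"
      using map_continuous_at_lipschitz[OF s, of 1 uminus] by simp
    then have "map_continuous_at (subtopology X F) (subtopology Y W) f (\<lambda>x. \<psi> x + - s x) y"
      by (intro map_continuous_at_add[OF \<psi>] map_continuous_at_subspace[OF _ W])
    then have diff: "map_continuous_at (subtopology X F) (subtopology Y W) f (\<lambda>x. \<psi> x - s x) y"
      by simp
    have "M * (2 / 3) ^ n > 0" using \<open>M > 0\<close> by simp
    then obtain V' h where V': "openin Y V'" "y \<in> V'" "V' \<subseteq> V" and h: "map_continuous_at X Y f h y"
      "\<forall>x\<in>topspace X. \<bar>h x\<bar> \<le> M * (2 / 3) ^ n / 3"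
      "\<forall>x\<in>F \<inter> preim X f V'. \<bar>\<psi> x - s x - h x\<bar> \<le> 2 * (M * (2 / 3) ^ n) / 3"
      by (rule map_continuous_at_approximation[OF f n W F diff V _ err])
    have "P (Suc n) (\<lambda>x. s x + h x, V')"
      unfolding P_def prod.case
    proof (intro conjI ballI)
      show "map_continuous_at X Y f (\<lambda>x. s x + h x) y" by (rule map_continuous_at_add[OF s h(1)])
      show "openin Y V'" "y \<in> V'" "V' \<subseteq> W" using V' V by auto
      show "\<bar>s x + h x\<bar> \<le> M * (1 - (2 / 3) ^ Suc n)" if "x \<in> topspace X" for x
      proof -
        have "\<bar>s x + h x\<bar> \<le> M * (1 - (2 / 3) ^ n) + M * (2 / 3) ^ n / 3"
          using range[OF that] bspec[OF h(2) that] by linarith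
        also have "\<dots> = M * (1 - (2 / 3) ^ Suc n)" by (simp add: field_simps)
        finally show ?thesis .
      qed
      show "\<bar>\<psi> x - (s x + h x)\<bar> \<le> M * (2 / 3) ^ Suc n" if "x \<in> F \<inter> preim X f V'" for x
        using bspec[OF h(3) that] by (simp add: field_simps)
    qed
    moreover have "Q n t (\<lambda>x. s x + h x, V')" using h(2) by (simp add: Q_def t)
    ultimately show ?thesis by blast
  qed
  ultimately obtain t where t: "\<And>n. P n (t n)" "\<And>n. Q n (t n) (t (Suc n))"
    using dependent_nat_choice[of P Q] by metis
  have P: "map_continuous_at X Y f (fst (t n)) y" "openin Y (snd (t n))" "y \<in> snd (t n)" "snd (t n) \<subseteq> W"
    "\<And>x. x \<in> topspace X \<Longrightarrow> \<bar>fst (t n) x\<bar> \<le> M * (1 - (2 / 3) ^ n)"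
    "\<And>x. x \<in> F \<inter> preim X f (snd (t n)) \<Longrightarrow> \<bar>\<psi> x - fst (t n) x\<bar> \<le> M * (2 / 3) ^ n" for n
    using t(1)[of n] by (auto simp: P_def case_prod_beta)
  have "M * (1 - (2 / 3) ^ n) \<le> M * 1" for n
    using \<open>M > 0\<close> by (intro mult_left_mono) auto
  then have "\<bar>fst (t n) x\<bar> \<le> M" if "x \<in> topspace X" for n x
    using P(5)[OF that, of n] by (metis mult.right_neutral order_trans)
  moreover have "\<bar>fst (t (Suc n)) x - fst (t n) x\<bar> \<le> M * (2 / 3) ^ n / 3" if "x \<in> topspace X" for n x
    using t(2)[of n] that by (simp add: Q_def case_prod_beta)
  ultimately show thesis
    using P by (intro that[of "\<lambda>n. fst (t n)" "\<lambda>n. snd (t n)"]) blast+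
qed

lemma geometric_increments_limit:
  fixes a :: "nat \<Rightarrow> real"
  assumes step: "\<And>n. \<bar>a (Suc n) - a n\<bar> \<le> M * (2 / 3) ^ n / 3"
  shows "convergent a" "\<bar>lim a - a n\<bar> \<le> M * (2 / 3) ^ n"
proof -
  have sums: "(\<lambda>k. M * (2 / 3) ^ k / 3) sums M"
  proof -
    have "(\<lambda>k. M / 3 * (2 / 3) ^ k) sums (M / 3 * (1 / (1 - 2 / 3)))"
      by (intro sums_mult geometric_sums) simp
    then show ?thesis by simp
  qed
  have "summable (\<lambda>k. a (Suc k) - a k)"
    by (rule summable_comparison_test[OF _ sums_summable[OF sums]]) (use step in auto)
  then have "convergent (\<lambda>n. a n - a 0)"
    using summable_iff_convergent[of "\<lambda>k. a (Suc k) - a k"] by (simp only: sum_lessThan_telescope)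
  then show conv: "convergent a"
    by (simp add: convergent_diff_const_right_iff)
  have dist: "\<bar>a (m + n) - a n\<bar> \<le> M * (2 / 3) ^ n - M * (2 / 3) ^ (m + n)" for m
  proof (induction m)
    case (Suc m)
    have "\<bar>a (Suc m + n) - a n\<bar> \<le> \<bar>a (Suc (m + n)) - a (m + n)\<bar> + \<bar>a (m + n) - a n\<bar>" by simp
    also have "\<dots> \<le> M * (2 / 3) ^ n - M * (2 / 3) ^ (Suc m + n)"
      using Suc step[of "m + n"] by simp
    finally show ?case .
  qed simp
  have "0 \<le> M" using order_trans[OF abs_ge_zero step[of 0]] by simp
  then have bnd: "\<bar>a (m + n) - a n\<bar> \<le> M * (2 / 3) ^ n" for m
  proof -
    have "0 \<le> M * (2 / 3) ^ (m + n)" using \<open>0 \<le> M\<close> by simp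
    then show ?thesis using dist[of m] by linarith
  qed
  have "(\<lambda>m. \<bar>a (m + n) - a n\<bar>) \<longlonglongrightarrow> \<bar>lim a - a n\<bar>"
    using conv by (intro tendsto_intros LIMSEQ_ignore_initial_segment) (simp add: convergent_LIMSEQ_iff)
  then show "\<bar>lim a - a n\<bar> \<le> M * (2 / 3) ^ n"
    by (rule LIMSEQ_le_const2) (use bnd in auto)
qed

text \<open>On \<open>F\<close> the limit of the approximating sequence agrees with \<open>\<psi>\<close> over the intersection of the
  neighbourhoods \<open>V n\<close>, which is a \<open>G\<^sub>\<delta>\<close>-set; over a single \<open>V n\<close> it agrees with \<open>\<psi>\<close> up to
  \<open>2 * M * (2 / 3) ^ n\<close>.\<close>

lemma tietze_for_normal_map:
  fixes \<psi> :: "'a \<Rightarrow> real"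
  assumes f: "continuous_map X Y f" and n: "normal_map X Y f"
    and W: "openin Y W" "y \<in> W" and F: "closedin (subtopology X (preim X f W)) F"
    and \<psi>: "map_continuous_at (subtopology X F) (subtopology Y W) f \<psi> y"
  shows "\<exists>\<phi> :: 'a \<Rightarrow> real.
           map_continuous_at X Y f \<phi> y \<and>
           (\<exists>G. gdelta_in (subtopology Y W) G \<and> y \<in> G \<and>
                (\<forall>x \<in> F \<inter> preim X f G. \<psi> x = \<phi> x)) \<and>
           (\<forall>x \<in> F \<inter> preim X f {y}. \<psi> x = \<phi> x) \<and>
           sup_norm (topspace X) \<phi> \<le> sup_norm F \<psi> \<and>
           (\<forall>\<epsilon>>0. \<exists>V. openin Y V \<and> V \<subseteq> W \<and> y \<in> V \<and>
                sup_norm (F \<inter> preim X f V) (\<lambda>x. \<psi> x - \<phi> x) < \<epsilon>)"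
proof -
  define M where "M = sup_norm F \<psi>"
  have "F \<subseteq> topspace X" using closedin_subset[OF F] by (auto simp: topspace_subtopology)
  then have "topspace (subtopology X F) = F" by (rule topspace_subtopology_subset)
  then have bnd: "bounded (\<psi> ` F)" using \<psi> by (simp add: map_continuous_at_iff)
  have \<psi>M: "\<bar>\<psi> x\<bar> \<le> M" if "x \<in> F" for x
    unfolding M_def by (rule sup_norm_upper[OF bnd that])
  have "0 \<le> M"
  proof (cases "F = {}")
    case False
    then obtain x where "x \<in> F" by blast
    then show ?thesis using \<psi>M[of x] by simp
  qed (simp add: M_def sup_norm_def)
  have "\<exists>\<phi> V. map_continuous_at X Y f \<phi> y \<and> (\<forall>x\<in>topspace X. \<bar>\<phi> x\<bar> \<le> M) \<and>
    (\<forall>n::nat. openin Y (V n) \<and> y \<in> V n \<and> V n \<subseteq> W \<and>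
      (\<forall>x\<in>F \<inter> preim X f (V n). \<bar>\<psi> x - \<phi> x\<bar> \<le> 2 * M * (2 / 3) ^ n))"
  \<comment> \<open>For \<open>M = 0\<close> the levels \<open>M / 3\<close> and \<open>- M / 3\<close> of Tietze's construction coincide, but the zero function
    extends \<open>\<psi>\<close>.\<close>
  proof (cases "M = 0")
    case True
    then show ?thesis
      using \<psi>M W map_continuous_at_zero[OF W] by (intro exI[of _ "\<lambda>x. 0"] exI[of _ "\<lambda>n. W"]) auto
  next
    case False
    then have "M > 0" using \<open>0 \<le> M\<close> by simp
    then obtain s V where s: "\<forall>n. map_continuous_at X Y f (s n) y"
      and V: "\<forall>n. openin Y (V n) \<and> y \<in> V n \<and> V n \<subseteq> W"
      and range: "\<forall>n. \<forall>x\<in>topspace X. \<bar>s n x\<bar> \<le> M"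
      and err: "\<forall>n. \<forall>x\<in>F \<inter> preim X f (V n). \<bar>\<psi> x - s n x\<bar> \<le> M * (2 / 3) ^ n"
      and incr: "\<forall>n. \<forall>x\<in>topspace X. \<bar>s (Suc n) x - s n x\<bar> \<le> M * (2 / 3) ^ n / 3"
      by (rule tietze_approximating_sequence[OF f n W F \<psi> _ \<psi>M])
    define \<phi> where "\<phi> x = lim (\<lambda>n. s n x)" for x
    have lim: "(\<lambda>n. s n x) \<longlonglongrightarrow> \<phi> x" if "x \<in> topspace X" for x
      using geometric_increments_limit(1)[of "\<lambda>n. s n x", OF incr[rule_format, OF that]]
      by (simp add: \<phi>_def convergent_LIMSEQ_iff)
    have tail: "\<bar>\<phi> x - s n x\<bar> \<le> M * (2 / 3) ^ n" if "x \<in> topspace X" for x n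
      using geometric_increments_limit(2)[of "\<lambda>n. s n x", OF incr[rule_format, OF that]] by (simp add: \<phi>_def)
    have "map_continuous_at X Y f \<phi> y"
    proof (rule map_continuous_at_uniform_limit)
      fix e :: real assume "e > 0"
      then obtain n where "(2 / 3) ^ n < e / M"
        using real_arch_pow_inv[of "e / M" "2 / 3"] \<open>M > 0\<close> by auto
      then have "M * (2 / 3) ^ n \<le> e" using \<open>M > 0\<close> by (simp add: field_simps)
      then have "\<forall>x\<in>topspace X. \<bar>\<phi> x - s n x\<bar> \<le> e" using tail order_trans by blast
      with s show "\<exists>s. map_continuous_at X Y f s y \<and> (\<forall>x\<in>topspace X. \<bar>\<phi> x - s x\<bar> \<le> e)" by blast
    qed
    moreover have "\<bar>\<phi> x\<bar> \<le> M" if "x \<in> topspace X" for x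
      using tendsto_rabs[OF lim[OF that]] by (rule LIMSEQ_le_const2) (use range that in auto)
    moreover have "\<bar>\<psi> x - \<phi> x\<bar> \<le> 2 * M * (2 / 3) ^ n" if "x \<in> F \<inter> preim X f (V n)" for x n
      using err[rule_format, OF that] tail[of x n] that by simp
    ultimately show ?thesis using V by (intro exI[of _ \<phi>] exI[of _ V]) blast
  qed
  then obtain \<phi> V where \<phi>: "map_continuous_at X Y f \<phi> y" "\<And>x. x \<in> topspace X \<Longrightarrow> \<bar>\<phi> x\<bar> \<le> M"
    and V: "\<And>n::nat. openin Y (V n)" "\<And>n. y \<in> V n" "\<And>n. V n \<subseteq> W"
    and err: "\<And>n x. x \<in> F \<inter> preim X f (V n) \<Longrightarrow> \<bar>\<psi> x - \<phi> x\<bar> \<le> 2 * M * (2 / 3) ^ n"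
    by blast
  have small: "\<exists>n. 2 * M * (2 / 3) ^ n < e" if "e > 0" for e :: real
  proof -
    have "(\<lambda>n. 2 * M * (2 / 3) ^ n) \<longlonglongrightarrow> 2 * M * 0"
      by (intro tendsto_intros LIMSEQ_realpow_zero) auto
    then have "eventually (\<lambda>n. 2 * M * (2 / 3) ^ n < e) sequentially"
      using that by (intro order_tendstoD(2)) auto
    then show ?thesis by (auto simp: eventually_sequentially)
  qed
  define G where "G = (\<Inter>n. V n)"
  have eq: "\<psi> x = \<phi> x" if "x \<in> F \<inter> preim X f G" for x
  proof (rule ccontr)
    assume "\<psi> x \<noteq> \<phi> x"
    then obtain n where "2 * M * (2 / 3) ^ n < \<bar>\<psi> x - \<phi> x\<bar>" using small[of "\<bar>\<psi> x - \<phi> x\<bar>"] by auto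
    moreover have "x \<in> F \<inter> preim X f (V n)" using that by (auto simp: G_def)
    ultimately show False using err[of x n] by simp
  qed
  have "y \<in> G" using V by (auto simp: G_def)
  have "openin (subtopology Y W) (V n)" for n
    using V W by (simp add: openin_open_subtopology)
  then have "gdelta_in (subtopology Y W) G"
    unfolding G_def by (intro gdelta_in_Inter) (auto intro: open_imp_gdelta_in)
  moreover have "sup_norm (topspace X) \<phi> \<le> sup_norm F \<psi>"
    using sup_norm_le[of "topspace X" \<phi> M] \<phi>(2) \<open>0 \<le> M\<close> by (simp add: M_def)
  moreover have "\<exists>V. openin Y V \<and> V \<subseteq> W \<and> y \<in> V \<and>
      sup_norm (F \<inter> preim X f V) (\<lambda>x. \<psi> x - \<phi> x) < e" if pos: "e > 0" for e
  proof -
    obtain n where n: "2 * M * (2 / 3) ^ n < e" using small[OF pos] by blast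
    have "sup_norm (F \<inter> preim X f (V n)) (\<lambda>x. \<psi> x - \<phi> x) \<le> 2 * M * (2 / 3) ^ n"
      using err \<open>0 \<le> M\<close> by (intro sup_norm_le) auto
    then show ?thesis using n V by (intro exI[of _ "V n"]) auto
  qed
  moreover have "\<forall>x \<in> F \<inter> preim X f {y}. \<psi> x = \<phi> x" using eq \<open>y \<in> G\<close> by blast
  ultimately show ?thesis
    using \<phi>(1) eq \<open>y \<in> G\<close> by blast
qed

section \<open>Separation by extended indicator functions\<close>

text \<open>Both sets are relatively clopen in their union, so the indicator is locally constant there.\<close>

lemma indicator_map_continuous_at:
  assumes W: "openin Y W" "y \<in> W"
    and F: "closedin (subtopology X P) F" and T: "closedin (subtopology X P) T" and "F \<inter> T = {}"
  shows "map_continuous_at (subtopology X (F \<union> T)) (subtopology Y W) f (indicat_real T) y"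
proof -
  let ?Z = "subtopology X (F \<union> T)"
  have sub: "F \<subseteq> P" "T \<subseteq> P" "F \<subseteq> topspace X" "T \<subseteq> topspace X"
    using closedin_subset[OF F] closedin_subset[OF T] by (simp_all add: topspace_subtopology)
  have part: "openin ?Z B" if A: "closedin (subtopology X P) A" and AB: "A \<inter> B = {}" "A \<union> B = F \<union> T" for A B
  proof -
    obtain C where C: "closedin X C" "A = C \<inter> P" using A unfolding closedin_subtopology by blast
    have "B = (topspace X - C) \<inter> (F \<union> T)"
    proof
      show "B \<subseteq> (topspace X - C) \<inter> (F \<union> T)" using AB C(2) sub by auto
      show "(topspace X - C) \<inter> (F \<union> T) \<subseteq> B" using AB(2) C(2) by auto
    qed
    moreover have "openin X (topspace X - C)" using C(1) by (rule openin_diff[OF openin_topspace])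
    ultimately show ?thesis unfolding openin_subtopology by blast
  qed
  have "openin ?Z F" "openin ?Z T"
    using part[OF T, of F] part[OF F, of T] \<open>F \<inter> T = {}\<close> by (simp_all add: Int_commute Un_commute)
  have osc: "osc_within ?Z (indicat_real T) e (F \<union> T)" if "e > 0" for e
    unfolding osc_within_def
  proof
    fix x assume "x \<in> F \<union> T"
    then consider "x \<in> T" | "x \<in> F" by blast
    then show "\<exists>U. openin ?Z U \<and> x \<in> U \<and> (\<forall>z\<in>U. \<bar>indicat_real T x - indicat_real T z\<bar> \<le> e)"
    proof cases
      case 1
      then show ?thesis using \<open>openin ?Z T\<close> \<open>e > 0\<close> by (intro exI[of _ T]) auto
    next
      case 2
      have "indicat_real T z = 0" if "z \<in> F" for z
        using that \<open>F \<inter> T = {}\<close> by (auto simp: indicator_def)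
      then show ?thesis using 2 \<open>openin ?Z F\<close> \<open>e > 0\<close> by (intro exI[of _ F]) auto
    qed
  qed
  show ?thesis
    unfolding map_continuous_at_iff
  proof (intro conjI allI impI)
    show "bounded (indicat_real T ` topspace ?Z)"
      unfolding bounded_real by (intro exI[of _ 1]) (auto simp: indicator_def)
    fix e :: real assume "e > 0"
    have "preim ?Z f W \<subseteq> F \<union> T" by (auto simp: topspace_subtopology)
    with osc[OF \<open>e > 0\<close>] have "osc_within ?Z (indicat_real T) e (preim ?Z f W)"
      by (rule osc_within_mono) simp
    moreover have "openin (subtopology Y W) W" using W(1) by (simp add: openin_open_subtopology)
    ultimately show "\<exists>V. openin (subtopology Y W) V \<and> y \<in> V \<and>
        osc_within ?Z (indicat_real T) e (preim ?Z f V)"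
      using W(2) by blast
  qed
qed

text \<open>The points near which a function lies below \<open>1 / 2\<close> form an open set, and so do those near which it
  lies above. With oscillation at most \<open>1 / 8\<close>, values at most \<open>1 / 4\<close> or at least \<open>3 / 4\<close> put a
  point into these sets.\<close>

lemma separation_of_approximate_indicator:
  assumes f: "continuous_map X Y f" and W: "openin Y W" "y \<in> W" and V: "openin Y V" "y \<in> V"
    and \<phi>: "map_continuous_at X Y f \<phi> y"
    and F: "\<And>x. x \<in> F \<inter> preim X f V \<Longrightarrow> \<phi> x \<le> 1 / 4"
    and T: "\<And>x. x \<in> T \<inter> preim X f V \<Longrightarrow> 3 / 4 \<le> \<phi> x"
  shows "\<exists>V S S'. openin Y V \<and> y \<in> V \<and> V \<subseteq> W \<and> openin X S \<and> openin X S' \<and>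
         F \<inter> preim X f V \<subseteq> S \<and> T \<inter> preim X f V \<subseteq> S' \<and> S \<inter> S' = {}"
proof -
  have "(1::real) / 8 > 0" by simp
  then obtain V1 where V1: "openin Y V1" "y \<in> V1" "osc_within X \<phi> (1 / 8) (preim X f V1)"
    using \<phi> unfolding map_continuous_at_iff by blast
  define S where "S = \<Union>{U. openin X U \<and> (\<forall>z\<in>U. \<phi> z < 1 / 2)}"
  define S' where "S' = \<Union>{U. openin X U \<and> (\<forall>z\<in>U. 1 / 2 < \<phi> z)}"
  have near: "\<exists>U. openin X U \<and> x \<in> U \<and> (\<forall>z\<in>U. \<bar>\<phi> x - \<phi> z\<bar> \<le> 1 / 8)" if "x \<in> preim X f V1" for x
    using V1(3) that unfolding osc_within_def by blast
  show ?thesis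
  proof (intro exI conjI)
    show "openin Y (V \<inter> V1 \<inter> W)" "y \<in> V \<inter> V1 \<inter> W" "V \<inter> V1 \<inter> W \<subseteq> W" using V V1 W by auto
    show "openin X S" "openin X S'" unfolding S_def S'_def by (intro openin_Union; blast)+
    show "F \<inter> preim X f (V \<inter> V1 \<inter> W) \<subseteq> S"
    proof
      fix x assume x: "x \<in> F \<inter> preim X f (V \<inter> V1 \<inter> W)"
      then obtain U where U: "openin X U" "x \<in> U" "\<forall>z\<in>U. \<bar>\<phi> x - \<phi> z\<bar> \<le> 1 / 8" using near by blast
      have "\<phi> x \<le> 1 / 4" using F x by blast
      have "\<phi> z < 1 / 2" if "z \<in> U" for z
        using bspec[OF U(3) that] \<open>\<phi> x \<le> 1 / 4\<close> by linarith
      then show "x \<in> S" using U unfolding S_def by blast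
    qed
    show "T \<inter> preim X f (V \<inter> V1 \<inter> W) \<subseteq> S'"
    proof
      fix x assume x: "x \<in> T \<inter> preim X f (V \<inter> V1 \<inter> W)"
      then obtain U where U: "openin X U" "x \<in> U" "\<forall>z\<in>U. \<bar>\<phi> x - \<phi> z\<bar> \<le> 1 / 8" using near by blast
      have "3 / 4 \<le> \<phi> x" using T x by blast
      have "1 / 2 < \<phi> z" if "z \<in> U" for z
        using bspec[OF U(3) that] \<open>3 / 4 \<le> \<phi> x\<close> by linarith
      then show "x \<in> S'" using U unfolding S'_def by blast
    qed
    show "S \<inter> S' = {}" unfolding S_def S'_def by fastforce
  qed
qed

section \<open>The four equivalent conditions\<close>

theorem theorem3p2:
  fixes X :: "'a topology" and Y :: "'b topology" and f :: "'a \<Rightarrow> 'b"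
  assumes "continuous_map X Y f"
  shows
    "(normal_map X Y f \<longleftrightarrow>
      (\<forall>W F T y. openin Y W \<and> closedin (subtopology X (preim X f W)) F \<and>
          closedin (subtopology X (preim X f W)) T \<and> F \<inter> T = {} \<and> y \<in> W \<longrightarrow>
        (\<exists>N U. consistent_binary_partitions X Y f y N U \<and>
          (\<forall>n\<ge>1.
             F \<inter> preim X f (N n) \<subseteq> U n 0 \<and>
             T \<inter> preim X f (N n) \<subseteq> U n (2 ^ n - 1) \<and>
             F \<inter> (subtopology X (preim X f (N n)) closure_of (\<Union>k\<in>{1..2 ^ n - 1}. U n k)) = {} \<and>
             (subtopology X (preim X f (N n)) closure_of (\<Union>k\<in>{0..2 ^ n - 2}. U n k)) \<inter> T = {}))))
     \<and>
     (normal_map X Y f \<longleftrightarrow>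
      (\<forall>W F T y. openin Y W \<and> closedin (subtopology X (preim X f W)) F \<and>
          closedin (subtopology X (preim X f W)) T \<and> F \<inter> T = {} \<and> y \<in> W \<longrightarrow>
        (\<exists>\<phi> :: 'a \<Rightarrow> real. \<exists>V.
           \<phi> ` topspace X \<subseteq> {0..1} \<and> map_continuous_at X Y f \<phi> y \<and>
           openin Y V \<and> y \<in> V \<and>
           osc_on X \<phi> (preim X f V) < 1 / 2 \<and>
           F \<inter> preim X f V \<subseteq> preim X \<phi> {0} \<inter> preim X f V \<and>
           T \<inter> preim X f V \<subseteq> preim X \<phi> {1} \<inter> preim X f V \<and>
           F \<inter> preim X f V \<subseteq>
             preim X f V -
               (subtopology X (preim X f V) closure_of (preim X \<phi> {1 / 2..1} \<inter> preim X f V)) \<and>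
           T \<inter> preim X f V \<subseteq>
             subtopology X (preim X f V) interior_of (preim X \<phi> {1 / 2..1} \<inter> preim X f V))))
     \<and>
     (normal_map X Y f \<longleftrightarrow>
      (\<forall>W F y. \<forall>\<psi> :: 'a \<Rightarrow> real.
          openin Y W \<and> F \<noteq> {} \<and> closedin (subtopology X (preim X f W)) F \<and> y \<in> W \<and>
          map_continuous_at (subtopology X F) (subtopology Y W) f \<psi> y \<longrightarrow>
        (\<exists>\<phi> :: 'a \<Rightarrow> real.
           map_continuous_at X Y f \<phi> y \<and>
           (\<exists>G. gdelta_in (subtopology Y W) G \<and> y \<in> G \<and>
                (\<forall>x \<in> F \<inter> preim X f G. \<psi> x = \<phi> x)) \<and>
           (\<forall>x \<in> F \<inter> preim X f {y}. \<psi> x = \<phi> x) \<and>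
           sup_norm (topspace X) \<phi> \<le> sup_norm F \<psi> \<and>
           (\<forall>\<epsilon>>0. \<exists>V. openin Y V \<and> V \<subseteq> W \<and> y \<in> V \<and>
                sup_norm (F \<inter> preim X f V) (\<lambda>x. \<psi> x - \<phi> x) < \<epsilon>))))"
    (is "(?A \<longleftrightarrow> ?B) \<and> (?A \<longleftrightarrow> ?C) \<and> (?A \<longleftrightarrow> ?D)")
proof -
  note f = assms
  have AB: ?B if n: ?A
  proof (intro allI impI, elim conjE)
    fix W F T y
    assume "openin Y W" "closedin (subtopology X (preim X f W)) F"
      "closedin (subtopology X (preim X f W)) T" "F \<inter> T = {}" "y \<in> W"
    then show "\<exists>N U. consistent_binary_partitions X Y f y N U \<and>
          (\<forall>n\<ge>1.
             F \<inter> preim X f (N n) \<subseteq> U n 0 \<and>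
             T \<inter> preim X f (N n) \<subseteq> U n (2 ^ n - 1) \<and>
             F \<inter> (subtopology X (preim X f (N n)) closure_of (\<Union>k\<in>{1..2 ^ n - 1}. U n k)) = {} \<and>
             (subtopology X (preim X f (N n)) closure_of (\<Union>k\<in>{0..2 ^ n - 2}. U n k)) \<inter> T = {})"
      by (intro normal_map_imp_consistent_partitions[OF f n])
  qed
  have BC: ?C if B: ?B
  proof (intro allI impI)
    fix W F T y
    assume *: "openin Y W \<and> closedin (subtopology X (preim X f W)) F \<and>
      closedin (subtopology X (preim X f W)) T \<and> F \<inter> T = {} \<and> y \<in> W"
    from B[THEN spec, THEN spec, THEN spec, THEN spec, THEN mp, OF *]
    show "\<exists>\<phi> :: 'a \<Rightarrow> real. \<exists>V.
           \<phi> ` topspace X \<subseteq> {0..1} \<and> map_continuous_at X Y f \<phi> y \<and>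
           openin Y V \<and> y \<in> V \<and>
           osc_on X \<phi> (preim X f V) < 1 / 2 \<and>
           F \<inter> preim X f V \<subseteq> preim X \<phi> {0} \<inter> preim X f V \<and>
           T \<inter> preim X f V \<subseteq> preim X \<phi> {1} \<inter> preim X f V \<and>
           F \<inter> preim X f V \<subseteq>
             preim X f V -
               (subtopology X (preim X f V) closure_of (preim X \<phi> {1 / 2..1} \<inter> preim X f V)) \<and>
           T \<inter> preim X f V \<subseteq>
             subtopology X (preim X f V) interior_of (preim X \<phi> {1 / 2..1} \<inter> preim X f V)"
      by (elim exE conjE) (rule urysohn_of_consistent_partitions[OF _ f])
  qed
  have CA: ?A if C: ?C
    unfolding normal_map_iff[OF f]
  proof (intro allI impI)
    fix W F T y
    assume W: "openin Y W" and F: "closedin (subtopology X (preim X f W)) F"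
      and T: "closedin (subtopology X (preim X f W)) T" and FT: "F \<inter> T = {}" and y: "y \<in> W"
    from C[THEN spec, THEN spec, THEN spec, THEN spec, THEN mp, OF conjI[OF W conjI[OF F conjI[OF T conjI[OF FT y]]]]]
    show "\<exists>V S S'. openin Y V \<and> y \<in> V \<and> V \<subseteq> W \<and> openin X S \<and> openin X S' \<and>
         F \<inter> preim X f V \<subseteq> S \<and> T \<inter> preim X f V \<subseteq> S' \<and> S \<inter> S' = {}"
      by (elim exE conjE) (rule separation_of_interior_closure[OF f W y])
  qed
  have AD: ?D if n: ?A
  proof (intro allI impI, elim conjE)
    fix W F y and \<psi> :: "'a \<Rightarrow> real"
    assume "openin Y W" "closedin (subtopology X (preim X f W)) F" "y \<in> W"
      "map_continuous_at (subtopology X F) (subtopology Y W) f \<psi> y"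
    then show "\<exists>\<phi> :: 'a \<Rightarrow> real.
           map_continuous_at X Y f \<phi> y \<and>
           (\<exists>G. gdelta_in (subtopology Y W) G \<and> y \<in> G \<and>
                (\<forall>x \<in> F \<inter> preim X f G. \<psi> x = \<phi> x)) \<and>
           (\<forall>x \<in> F \<inter> preim X f {y}. \<psi> x = \<phi> x) \<and>
           sup_norm (topspace X) \<phi> \<le> sup_norm F \<psi> \<and>
           (\<forall>\<epsilon>>0. \<exists>V. openin Y V \<and> V \<subseteq> W \<and> y \<in> V \<and>
                sup_norm (F \<inter> preim X f V) (\<lambda>x. \<psi> x - \<phi> x) < \<epsilon>)"
      by (intro tietze_for_normal_map[OF f n])
  qed
  have DA: ?A if D: ?D
    unfolding normal_map_iff[OF f]
  proof (intro allI impI)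
    fix W F T y
    assume W: "openin Y W" and F: "closedin (subtopology X (preim X f W)) F"
      and T: "closedin (subtopology X (preim X f W)) T" and FT: "F \<inter> T = {}" and y: "y \<in> W"
    show "\<exists>V S S'. openin Y V \<and> y \<in> V \<and> V \<subseteq> W \<and> openin X S \<and> openin X S' \<and>
         F \<inter> preim X f V \<subseteq> S \<and> T \<inter> preim X f V \<subseteq> S' \<and> S \<inter> S' = {}"
    \<comment> \<open>Extension applies to non-empty closed sets only.\<close>
    proof (cases "F \<union> T = {}")
      case True
      then show ?thesis
        using W y by (intro exI[of _ W] exI[of _ "{}"]) auto
    next
      case False
      let ?\<psi> = "indicat_real T"
      have "closedin (subtopology X (preim X f W)) (F \<union> T)" using F T by (rule closedin_Un)
      moreover have "map_continuous_at (subtopology X (F \<union> T)) (subtopology Y W) f ?\<psi> y"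
        by (rule indicator_map_continuous_at[OF W y F T FT])
      ultimately have "openin Y W \<and> F \<union> T \<noteq> {} \<and> closedin (subtopology X (preim X f W)) (F \<union> T) \<and>
          y \<in> W \<and> map_continuous_at (subtopology X (F \<union> T)) (subtopology Y W) f ?\<psi> y"
        using W y False by (intro conjI)
      from D[THEN spec, THEN spec, THEN spec, THEN spec, THEN mp, OF this]
      obtain \<phi> :: "'a \<Rightarrow> real" where \<phi>: "map_continuous_at X Y f \<phi> y"
        and small: "\<forall>\<epsilon>>0. \<exists>V. openin Y V \<and> V \<subseteq> W \<and> y \<in> V \<and>
                sup_norm ((F \<union> T) \<inter> preim X f V) (\<lambda>x. ?\<psi> x - \<phi> x) < \<epsilon>"
        by (elim exE conjE)
      have "(0::real) < 1 / 4" by simp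
      from small[rule_format, OF this]
      obtain V where V: "openin Y V" "y \<in> V"
        and near: "sup_norm ((F \<union> T) \<inter> preim X f V) (\<lambda>x. ?\<psi> x - \<phi> x) < 1 / 4"
        by (elim exE conjE)
      have "bounded (\<phi> ` topspace X)" using \<phi> by (simp only: map_continuous_at_iff)
      then obtain M where M: "\<And>x. x \<in> topspace X \<Longrightarrow> \<bar>\<phi> x\<bar> \<le> M"
        by (rule bounded_imageE) blast
      have "\<bar>?\<psi> x - \<phi> x\<bar> \<le> 1 + M" if "x \<in> (F \<union> T) \<inter> preim X f V" for x
      proof -
        have "x \<in> topspace X" using that by simp
        from M[OF this] show ?thesis by (cases "x \<in> T") auto
      qed
      then have "bounded ((\<lambda>x. ?\<psi> x - \<phi> x) ` ((F \<union> T) \<inter> preim X f V))"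
        unfolding bounded_real by blast
      note sup_norm_upper[OF this]
      with near have close: "\<bar>?\<psi> x - \<phi> x\<bar> < 1 / 4" if "x \<in> (F \<union> T) \<inter> preim X f V" for x
        using that by fastforce
      show ?thesis
      proof (rule separation_of_approximate_indicator[OF f W y V \<phi>])
        show "\<phi> x \<le> 1 / 4" if "x \<in> F \<inter> preim X f V" for x
        proof -
          have "?\<psi> x = 0" using that FT by (auto simp: indicator_def)
          then show ?thesis using close[of x] that by auto
        qed
        show "3 / 4 \<le> \<phi> x" if "x \<in> T \<inter> preim X f V" for x
        proof -
          have "?\<psi> x = 1" using that by simp
          then have "\<bar>1 - \<phi> x\<bar> < 1 / 4" using close[of x] that by simp
          then show ?thesis by linarith
        qed
      qed
    qed
  qed
  show ?thesis
  proof (intro conjI)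
    show "?A \<longleftrightarrow> ?B" by (rule iffI[OF AB CA[OF BC]])
    show "?A \<longleftrightarrow> ?C" by (rule iffI[OF BC[OF AB] CA])
    show "?A \<longleftrightarrow> ?D" by (rule iffI[OF AD DA])
  qed
qed

end
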